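(* The right quaternionic Hilbert space $\mathcal F^2_0(\widetilde{\mathbb H})$ (the case $m=0$) coincides with the full hyperholomorphic Bargmann-Fock space: $$\mathcal F^2_0(\widetilde{\mathbb H})=\mathcal F^2_{full}(\widetilde{\mathbb H}):=\mathcal{SR}(\widetilde{\mathbb H})\cap L^2(\widetilde{\mathbb H};e^{-|q|^2}d\lambda).$$
   Context: $\mathbb H$ is the division algebra of real quaternions, $\mathbb S=\{q\in\mathbb H: q^2=-1\}$, $\widetilde{\mathbb H}=\mathbb H\setminus\mathbb R$, and $\mathbb C_I=\mathbb R+\mathbb RI$ for $I\in\mathbb S$. Points $q\in\widetilde{\mathbb H}$ are written $q=x+I_qy$ with $x,y\in\mathbb R$, $I_q\in\mathbb S$, or $q=re^{I\theta}$ in polar form. The operator $\Box_q$ acts on $\mathbb H$-valued functions on $\widetilde{\mathbb H}$ by $$\Box_q=-\frac14\Big(\frac{\partial^2}{\partial x^2}+\frac{\partial^2}{\partial y^2}\Big)+\frac12\Big(x\frac{\partial}{\partial x}+y\frac{\partial}{\partial y}\Big)+\frac{I_q}{2}\Big(x\frac{\partial}{\partial y}-y\frac{\partial}{\partial x}\Big).$$ $L^2(\widetilde{\mathbb H};e^{-|q|^2}d\lambda)$ is the right quaternionic Hilbert space of square integrable $\mathbb H$-valued functions with inner product $\langle f,g\rangle=\int\overline{f}g\,e^{-|q|^2}d\lambda$, where $$\int_{\widetilde{\mathbb H}}F(q)e^{-|q|^2}d\lambda(q)=\int_{\mathbb S}\int_0^{2\pi}\int_0^\infty F(re^{I\theta})e^{-r^2}\,r\,dr\,d\theta\,d\sigma(I),$$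 $d\sigma$ being the area element on $\mathbb S$. For an integer $m\ge 0$, $\mathcal F^2_m(\widetilde{\mathbb H})=\{f\in L^2(\widetilde{\mathbb H};e^{-|q|^2}d\lambda):\Box_qf=mf\}$. For an open set $\Omega\subset\mathbb H$, $\mathcal{SR}(\Omega)$ is the space of (left) slice regular functions: real differentiable $f:\Omega\to\mathbb H$ such that, for every $I\in\mathbb S$, the restriction $f_I$ of $f$ to $\Omega\cap\mathbb C_I$ has continuous partial derivatives and satisfies $\frac12\big(\frac{\partial}{\partial x}+I\frac{\partial}{\partial y}\big)f_I(x+Iy)=0$.
   Formalization: Functions in the eigenspace are additionally required to be real differentiable on the non-real quaternions and twice continuously differentiable along each slice; otherwise a rough function of I_q alone is a square integrable solution that is not slice regular. *)

theory Defs
  imports "HOL-Analysis.Analysis"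
begin

section \<open>The normed division algebra of real quaternions\<close>

datatype quat = Quat (qre: real) (qi: real) (qj: real) (qk: real)

lemma quat_eq_iff: "p = q \<longleftrightarrow> qre p = qre q \<and> qi p = qi q \<and> qj p = qj q \<and> qk p = qk q"
  by (cases p; cases q) simp

lemma quat_eqI:
  "qre p = qre q \<Longrightarrow> qi p = qi q \<Longrightarrow> qj p = qj q \<Longrightarrow> qk p = qk q \<Longrightarrow> p = q"
  by (simp add: quat_eq_iff)

instantiation quat :: real_vector
begin

definition zero_quat: "0 = Quat 0 0 0 0"
definition plus_quat: "p + q = Quat (qre p + qre q) (qi p + qi q) (qj p + qj q) (qk p + qk q)"
definition uminus_quat: "- p = Quat (- qre p) (- qi p) (- qj p) (- qk p)"
definition minus_quat: "p - q = Quat (qre p - qre q) (qi p - qi q) (qj p - qj q) (qk p - qk q)"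
definition scaleR_quat: "r *\<^sub>R q = Quat (r * qre q) (r * qi q) (r * qj q) (r * qk q)"

instance
  by standard
    (simp_all add: zero_quat plus_quat uminus_quat minus_quat scaleR_quat algebra_simps)

end

lemma quat_sel_vector [simp]:
  "qre 0 = 0" "qi 0 = 0" "qj 0 = 0" "qk 0 = 0"
  "qre (p + q) = qre p + qre q" "qi (p + q) = qi p + qi q"
  "qj (p + q) = qj p + qj q" "qk (p + q) = qk p + qk q"
  "qre (- p) = - qre p" "qi (- p) = - qi p" "qj (- p) = - qj p" "qk (- p) = - qk p"
  "qre (p - q) = qre p - qre q" "qi (p - q) = qi p - qi q"
  "qj (p - q) = qj p - qj q" "qk (p - q) = qk p - qk q"
  "qre (r *\<^sub>R q) = r * qre q" "qi (r *\<^sub>R q) = r * qi q"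
  "qj (r *\<^sub>R q) = r * qj q" "qk (r *\<^sub>R q) = r * qk q"
  by (simp_all add: zero_quat plus_quat uminus_quat minus_quat scaleR_quat)

instantiation quat :: real_inner
begin

definition inner_quat:
  "inner p q = qre p * qre q + qi p * qi q + qj p * qj q + qk p * qk q"
definition norm_quat: "norm q = sqrt ((qre q)\<^sup>2 + (qi q)\<^sup>2 + (qj q)\<^sup>2 + (qk q)\<^sup>2)"
definition sgn_quat: "sgn q = q /\<^sub>R norm q" for q :: quat
definition dist_quat: "dist p q = norm (p - q)" for p q :: quat
definition uniformity_quat:
  "(uniformity :: (quat \<times> quat) filter) = (INF e\<in>{0 <..}. principal {(p, q). dist p q < e})"
definition open_quat:
  "open (U :: quat set) \<longleftrightarrow> (\<forall>x\<in>U. eventually (\<lambda>(x', y). x' = x \<longrightarrow> y \<in> U) uniformity)"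

instance
proof
  fix p q s :: quat and r :: real
  show "inner p q = inner q p"
    by (simp add: inner_quat mult.commute)
  show "inner (p + q) s = inner p s + inner q s"
    by (simp add: inner_quat algebra_simps)
  show "inner (r *\<^sub>R p) q = r * inner p q"
    by (simp add: inner_quat algebra_simps)
  show "0 \<le> inner p p"
    by (simp add: inner_quat)
  show "inner p p = 0 \<longleftrightarrow> p = 0"
    by (simp add: inner_quat quat_eq_iff add_nonneg_eq_0_iff)
  show "norm p = sqrt (inner p p)"
    by (simp add: inner_quat norm_quat power2_eq_square)
qed (rule sgn_quat dist_quat uniformity_quat open_quat)+

end

instantiation quat :: euclidean_space
begin

definition Basis_quat:
  "Basis = {Quat 1 0 0 0, Quat 0 1 0 0, Quat 0 0 1 0, Quat 0 0 0 1}"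

instance
proof
  fix u v :: quat
  show "inner u v = (if u = v then 1 else 0)" if "u \<in> Basis" "v \<in> Basis"
    using that unfolding Basis_quat by (elim insertE emptyE) (simp_all add: inner_quat)
  show "(\<forall>v\<in>Basis. inner u v = 0) \<longleftrightarrow> u = 0"
    unfolding Basis_quat by (simp add: inner_quat) (simp add: quat_eq_iff conj_ac)
qed (simp_all add: Basis_quat)

end

instantiation quat :: real_normed_div_algebra
begin

definition one_quat: "1 = Quat 1 0 0 0"
definition times_quat:
  "p * q = Quat (qre p * qre q - qi p * qi q - qj p * qj q - qk p * qk q)
                (qre p * qi q + qi p * qre q + qj p * qk q - qk p * qj q)
                (qre p * qj q - qi p * qk q + qj p * qre q + qk p * qi q)
                (qre p * qk q + qi p * qj q - qj p * qi q + qk p * qre q)"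
definition inverse_quat:
  "inverse q = Quat (qre q) (- qi q) (- qj q) (- qk q) /\<^sub>R (norm q)\<^sup>2"
definition divide_quat: "p div q = p * inverse q" for p q :: quat

instance
proof
  fix p q s :: quat and r :: real
  show "p * q * s = p * (q * s)" "1 * p = p" "p * 1 = p"
    "(p + q) * s = p * s + q * s" "p * (q + s) = p * q + p * s"
    "r *\<^sub>R p * q = r *\<^sub>R (p * q)" "p * r *\<^sub>R q = r *\<^sub>R (p * q)"
    by (simp_all add: times_quat one_quat quat_eq_iff algebra_simps)
  show "(0 :: quat) \<noteq> 1"
    by (simp add: zero_quat one_quat)
  show "inverse (0 :: quat) = 0"
    by (simp add: inverse_quat quat_eq_iff)
  show "p div q = p * inverse q"
    by (rule divide_quat)
  have *: "(norm p)\<^sup>2 = (qre p)\<^sup>2 + (qi p)\<^sup>2 + (qj p)\<^sup>2 + (qk p)\<^sup>2" for p :: quat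
    by (simp add: norm_quat)
  {
    assume "p \<noteq> 0"
    then have n: "(norm p)\<^sup>2 \<noteq> 0"
      by simp
    let ?c = "Quat (qre p) (- qi p) (- qj p) (- qk p)"
    have "?c * p = (norm p)\<^sup>2 *\<^sub>R 1" "p * ?c = (norm p)\<^sup>2 *\<^sub>R 1"
      unfolding * by (simp_all add: times_quat one_quat quat_eq_iff power2_eq_square algebra_simps)
    moreover have "(a /\<^sub>R t) * b = (a * b) /\<^sub>R t" "b * (a /\<^sub>R t) = (b * a) /\<^sub>R t"
      for a b :: quat and t :: real
      by (simp_all add: times_quat quat_eq_iff algebra_simps)
    ultimately show "inverse p * p = 1" "p * inverse p = 1"
      using n by (simp_all add: inverse_quat)
  }
  have "(norm (p * q))\<^sup>2 = (norm p * norm q)\<^sup>2"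
    unfolding power_mult_distrib * times_quat quat.sel by algebra
  then show "norm (p * q) = norm p * norm q"
    by (meson norm_ge_zero mult_nonneg_nonneg power2_eq_imp_eq)
qed

end

section \<open>Slices\<close>

definition imag_units :: "quat set"
  where "imag_units = {q. q\<^sup>2 = -1}"

definition nonreal :: "quat set"
  where "nonreal = - \<real>"

definition slice_pt :: "quat \<Rightarrow> real \<times> real \<Rightarrow> quat"
  where "slice_pt I = (\<lambda>(x, y). of_real x + I * of_real y)"

definition slice_dom :: "quat \<Rightarrow> quat set \<Rightarrow> (real \<times> real) set"
  where "slice_dom I \<Omega> = slice_pt I -` \<Omega>"

definition slice_restr :: "quat \<Rightarrow> (quat \<Rightarrow> quat) \<Rightarrow> real \<times> real \<Rightarrow> quat"
  where "slice_restr I f = f \<circ> slice_pt I"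

definition qim :: "quat \<Rightarrow> quat"
  where "qim q = q - of_real (qre q)"

text \<open>The representation \<open>q = x + I\<^sub>q y\<close> of a non-real \<open>q\<close> is normalised by \<open>y = \<bar>Im q\<bar> > 0\<close>.
  The other representation, with \<open>(x, -y, -I\<^sub>q)\<close>, gives the same value of the operator \<open>box\<close> below.\<close>

definition imag_unit :: "quat \<Rightarrow> quat"
  where "imag_unit q = qim q /\<^sub>R norm (qim q)"

definition slice_coord :: "quat \<Rightarrow> real \<times> real"
  where "slice_coord q = (qre q, norm (qim q))"

lemma imag_units_iff: "I \<in> imag_units \<longleftrightarrow> qre I = 0 \<and> norm I = 1"
proof
  assume "I \<in> imag_units"
  then have I: "I * I = - 1"
    by (simp add: imag_units_def power2_eq_square)
  have "norm (I * I) = 1"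
    by (simp add: I)
  then have n: "norm I = 1"
    unfolding norm_mult by (metis norm_ge_zero power2_eq_square power2_eq_1_iff
        neg_0_le_iff_le not_one_le_zero)
  have "qre (I * I) = - 1"
    by (simp add: I one_quat)
  moreover have "(norm I)\<^sup>2 = (qre I)\<^sup>2 + (qi I)\<^sup>2 + (qj I)\<^sup>2 + (qk I)\<^sup>2"
    by (simp add: norm_quat)
  ultimately have "qre I * qre I - qi I * qi I - qj I * qj I - qk I * qk I = - 1"
    "1 = qre I * qre I + qi I * qi I + qj I * qj I + qk I * qk I"
    using n by (simp_all add: times_quat power2_eq_square)
  then have "qre I * qre I = 0"
    by linarith
  then show "qre I = 0 \<and> norm I = 1"
    using n by simp
next
  assume I: "qre I = 0 \<and> norm I = 1"
  then have "(norm I)\<^sup>2 = 1"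
    by simp
  then have "qi I * qi I + qj I * qj I + qk I * qk I = 1"
    using I by (simp add: norm_quat power2_eq_square)
  moreover from this have "- (qi I * qi I) - qj I * qj I - qk I * qk I = - 1"
    by linarith
  ultimately show "I \<in> imag_units"
    using I by (simp add: imag_units_def power2_eq_square times_quat one_quat quat_eq_iff)
qed

lemma of_real_quat: "of_real r = Quat r 0 0 0"
  by (simp add: of_real_def one_quat scaleR_quat)

lemma qim_eq_0_iff: "qim q = 0 \<longleftrightarrow> q \<in> \<real>"
  by (auto simp: qim_def of_real_quat Reals_def quat_eq_iff)

lemma imag_unit_in_imag_units: "q \<in> nonreal \<Longrightarrow> imag_unit q \<in> imag_units"
  by (auto simp: nonreal_def imag_units_iff imag_unit_def qim_eq_0_iff)
    (simp add: qim_def of_real_quat)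

lemma slice_pt_slice_coord: "q \<in> nonreal \<Longrightarrow> slice_pt (imag_unit q) (slice_coord q) = q"
proof -
  assume "q \<in> nonreal"
  then have "qim q \<noteq> 0"
    by (simp add: nonreal_def qim_eq_0_iff)
  then have "imag_unit q * of_real (norm (qim q)) = qim q"
    by (simp add: imag_unit_def of_real_def)
  then show ?thesis
    by (simp add: slice_pt_def slice_coord_def qim_def)
qed

section \<open>Partial derivatives\<close>

definition pdx :: "(real \<times> real \<Rightarrow> quat) \<Rightarrow> real \<times> real \<Rightarrow> quat"
  where "pdx g = (\<lambda>(x, y). vector_derivative (\<lambda>t. g (t, y)) (at x))"

definition pdy :: "(real \<times> real \<Rightarrow> quat) \<Rightarrow> real \<times> real \<Rightarrow> quat"
  where "pdy g = (\<lambda>(x, y). vector_derivative (\<lambda>t. g (x, t)) (at y))"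

definition cont_partials_on :: "(real \<times> real) set \<Rightarrow> (real \<times> real \<Rightarrow> quat) \<Rightarrow> bool"
  where "cont_partials_on D g \<longleftrightarrow>
    (\<forall>(x, y)\<in>D. (\<lambda>t. g (t, y)) differentiable at x \<and> (\<lambda>t. g (x, t)) differentiable at y) \<and>
    continuous_on D (pdx g) \<and> continuous_on D (pdy g)"

definition cont_partials2_on :: "(real \<times> real) set \<Rightarrow> (real \<times> real \<Rightarrow> quat) \<Rightarrow> bool"
  where "cont_partials2_on D g \<longleftrightarrow>
    cont_partials_on D g \<and> cont_partials_on D (pdx g) \<and> cont_partials_on D (pdy g)"

section \<open>Slice regular functions\<close>

text \<open>A function on \<open>\<Omega>\<close> is represented by a total function; for open \<open>\<Omega>\<close> its values
  outside \<open>\<Omega>\<close> play no role in any of the conditions below.\<close>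

definition slice_regular :: "quat set \<Rightarrow> (quat \<Rightarrow> quat) set"
  where "slice_regular \<Omega> = {f.
    (\<forall>q\<in>\<Omega>. f differentiable at q) \<and>
    (\<forall>I\<in>imag_units.
       cont_partials_on (slice_dom I \<Omega>) (slice_restr I f) \<and>
       (\<forall>z\<in>slice_dom I \<Omega>.
          (1/2) *\<^sub>R (pdx (slice_restr I f) z + I * pdy (slice_restr I f) z) = 0))}"

section \<open>The slice operator and its domain\<close>

definition box :: "(quat \<Rightarrow> quat) \<Rightarrow> quat \<Rightarrow> quat"
  where "box f q =
    (let I = imag_unit q; z = slice_coord q; x = fst z; y = snd z; g = slice_restr I f in
       - (1/4) *\<^sub>R (pdx (pdx g) z + pdy (pdy g) z)
       + (1/2) *\<^sub>R (x *\<^sub>R pdx g z + y *\<^sub>R pdy g z)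
       + (I /\<^sub>R 2) * (x *\<^sub>R pdy g z - y *\<^sub>R pdx g z))"

text \<open>The operator is applied in the classical sense: to functions that are real differentiable
  (as slice regular functions are) and twice continuously differentiable along each slice.
  As \<open>box\<close> only differentiates along slices, it puts no restriction on the dependence on \<open>I\<^sub>q\<close>:
  every \<open>q \<mapsto> a (I\<^sub>q)\<close> satisfies \<open>box f = 0\<close> but is not slice regular for rough \<open>a\<close>.\<close>

definition box_domain :: "(quat \<Rightarrow> quat) set"
  where "box_domain = {f.
    (\<forall>q\<in>nonreal. f differentiable at q) \<and>
    (\<forall>I\<in>imag_units. cont_partials2_on (slice_dom I nonreal) (slice_restr I f))}"

section \<open>The weighted space of square integrable functions\<close>

text \<open>The area element of the two-sphere of imaginary units, in spherical coordinates.\<close>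

definition sphere_area :: "quat measure"
  where "sphere_area =
    distr (density lborel (\<lambda>(\<phi>, \<psi>). ennreal (sin \<phi>) * indicator ({0..pi} \<times> {0..2*pi}) (\<phi>, \<psi>)))
      borel
      (\<lambda>(\<phi>, \<psi>). Quat 0 (sin \<phi> * cos \<psi>) (sin \<phi> * sin \<psi>) (cos \<phi>))"

definition slice_polar :: "quat \<times> real \<times> real \<Rightarrow> quat"
  where "slice_polar = (\<lambda>(I, \<theta>, r). slice_pt I (r * cos \<theta>, r * sin \<theta>))"

definition slice_measure :: "quat measure"
  where "slice_measure = restrict_space
    (distr
      (sphere_area \<Otimes>\<^sub>M
        density lborel (\<lambda>(\<theta>, r). ennreal r * indicator ({0..2*pi} \<times> {0..}) (\<theta>, r)))
      borel slice_polar)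
    nonreal"

definition gauss_slice_measure :: "quat measure"
  where "gauss_slice_measure = density slice_measure (\<lambda>q. ennreal (exp (- (norm q)\<^sup>2)))"

lemma nonreal_borel [measurable]: "nonreal \<in> sets borel"
proof -
  have q: "qim = (\<lambda>q. q - inner q 1 *\<^sub>R 1)"
    by (simp add: fun_eq_iff qim_def inner_quat one_quat of_real_def)
  have "continuous_on UNIV (\<lambda>q::quat. q - inner q 1 *\<^sub>R 1)"
    by (intro continuous_intros)
  then have "continuous_on UNIV qim"
    by (simp only: q)
  then have "closed {q. qim q = 0}"
    by (intro closed_Collect_eq) auto
  then have "closed (\<real> :: quat set)"
    by (simp add: qim_eq_0_iff)
  then show ?thesis
    by (simp add: nonreal_def borel_closed)
qed

lemma sets_sphere_area [measurable_cong]: "sets sphere_area = sets borel"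
  by (simp add: sphere_area_def)

lemma measurable_slice_polar [measurable]:
  "slice_polar \<in> borel_measurable (borel \<Otimes>\<^sub>M (borel \<Otimes>\<^sub>M borel))"
  unfolding borel_prod slice_polar_def slice_pt_def case_prod_beta
  by (intro borel_measurable_continuous_onI continuous_intros)


lemma slice_polar_exp:
  assumes "I \<in> imag_units"
  shows "slice_polar (I, \<theta>, r) = of_real r * exp (\<theta> *\<^sub>R I)"
proof -
  define h where "h = (\<lambda>z. of_real (Re z) + Im z *\<^sub>R I)"
  have II: "I * I = -1" using assms by (simp add: imag_units_def power2_eq_square)
  interpret h: bounded_linear h
    unfolding h_def by (intro bounded_linear_intros bounded_linear_compose[OF bounded_linear_of_real] bounded_linear_Re bounded_linear_Im)
  have hm: "h (z * w) = h z * h w" for z w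
    using II by (simp add: h_def algebra_simps of_real_def)
  have h1: "h 1 = 1" by (simp add: h_def)
  have hp: "h (z ^ n) = h z ^ n" for z n
    by (induction n) (simp_all add: hm h1)
  have "(\<lambda>n. (\<i> * of_real \<theta>) ^ n /\<^sub>R fact n) sums exp (\<i> * of_real \<theta>)"
    by (rule exp_converges)
  from h.sums[OF this] have "(\<lambda>n. h (\<i> * of_real \<theta>) ^ n /\<^sub>R fact n) sums h (exp (\<i> * of_real \<theta>))"
    by (simp add: h.scaleR hp)
  moreover have "h (\<i> * of_real \<theta>) = \<theta> *\<^sub>R I" by (simp add: h_def)
  moreover have "h (exp (\<i> * of_real \<theta>)) = of_real (cos \<theta>) + sin \<theta> *\<^sub>R I"
    by (simp add: h_def Re_exp Im_exp)
  ultimately have "exp (\<theta> *\<^sub>R I) = of_real (cos \<theta>) + sin \<theta> *\<^sub>R I"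
    by (metis exp_converges sums_unique2)
  then show ?thesis
    by (simp add: slice_polar_def slice_pt_def of_real_def algebra_simps)
qed

lemma measurable_spherical_coords: "(\<lambda>(\<phi>, \<psi>). Quat 0 (sin \<phi> * cos \<psi>) (sin \<phi> * sin \<psi>) (cos \<phi>)) \<in> borel_measurable (borel :: (real\<times>real) measure)"
proof -
  have "Quat a b c d = a *\<^sub>R Quat 1 0 0 0 + b *\<^sub>R Quat 0 1 0 0 + c *\<^sub>R Quat 0 0 1 0 + d *\<^sub>R Quat 0 0 0 1" for a b c d
    by (simp add: quat_eq_iff)
  then have "(\<lambda>(\<phi>, \<psi>). Quat 0 (sin \<phi> * cos \<psi>) (sin \<phi> * sin \<psi>) (cos \<phi>)) = (\<lambda>z. 0 *\<^sub>R Quat 1 0 0 0 + (sin (fst z) * cos (snd z)) *\<^sub>R Quat 0 1 0 0 + (sin (fst z) * sin (snd z)) *\<^sub>R Quat 0 0 1 0 + cos (fst z) *\<^sub>R Quat 0 0 0 1)"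
    by (simp add: fun_eq_iff quat_eq_iff)
  then show ?thesis by (auto intro!: borel_measurable_continuous_onI continuous_intros)
qed

lemma emeasure_sphere_area: "emeasure sphere_area UNIV = ennreal (4*pi)"
proof -
  have [measurable]: "{0..pi} \<times> {0..2*pi} \<in> sets (borel :: (real\<times>real) measure)" by (intro borel_closed closed_Times) auto
  have [measurable]: "(\<lambda>x::real\<times>real. ennreal (sin (fst x))) \<in> borel_measurable borel"
    by (intro measurable_compose[OF _ measurable_ennreal] borel_measurable_continuous_onI continuous_intros)
  have "emeasure sphere_area UNIV = (\<integral>\<^sup>+z. ennreal (sin (fst z)) * indicator ({0..pi} \<times> {0..2*pi}) z \<partial>lborel)"
    unfolding sphere_area_def using measurable_spherical_coords
    unfolding case_prod_beta prod.collapse by (simp add: emeasure_distr emeasure_density)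
  also have "\<dots> = (\<integral>\<^sup>+z. ennreal (sin (fst z)) * indicator ({0..pi} \<times> {0..2*pi}) z \<partial>(lborel \<Otimes>\<^sub>M lborel))"
    by (simp add: lborel_prod)
  also have "\<dots> = (\<integral>\<^sup>+\<phi>. \<integral>\<^sup>+\<psi>. ennreal (sin \<phi>) * indicator ({0..pi} \<times> {0..2*pi}) (\<phi>,\<psi>) \<partial>lborel \<partial>lborel)"
    by (subst lborel.nn_integral_fst[symmetric]) (simp_all add: lborel_prod)
  also have "\<dots> = (\<integral>\<^sup>+\<phi>. (\<integral>\<^sup>+\<psi>. (ennreal (sin \<phi>) * indicator {0..pi} \<phi>) * indicator {0..2*pi} \<psi> \<partial>lborel) \<partial>lborel)"
    by (simp add: indicator_times mult.assoc)
  also have "\<dots> = (\<integral>\<^sup>+\<phi>. ennreal (2*pi) * (ennreal (sin \<phi>) * indicator {0..pi} \<phi>) \<partial>lborel)"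
    by (subst nn_integral_cmult_indicator) (simp_all add: mult.commute)
  also have "\<dots> = ennreal (2*pi) * (\<integral>\<^sup>+\<phi>. (ennreal (sin \<phi>) * indicator {0..pi} \<phi>) \<partial>lborel)"
    by (rule nn_integral_cmult) measurable
  also have "(\<integral>\<^sup>+\<phi>. (ennreal (sin \<phi>) * indicator {0..pi} \<phi>) \<partial>lborel) = ennreal (- cos pi - - cos 0)"
    by (rule nn_integral_FTC_Icc) (auto intro!: derivative_eq_intros simp: sin_ge_zero)
  finally show ?thesis by (simp flip: ennreal_mult ennreal_numeral)
qed

lemma nn_integral_gauss_slice_measure:
  fixes F :: "quat \<Rightarrow> ennreal"
  assumes [measurable]: "F \<in> borel_measurable borel"
  shows "(\<integral>\<^sup>+q. F q \<partial>gauss_slice_measure) =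
    (\<integral>\<^sup>+I. \<integral>\<^sup>+\<theta>. \<integral>\<^sup>+r.
       ennreal r * indicator ({0..2*pi} \<times> {0..}) (\<theta>, r) * (ennreal (exp (- (norm (slice_polar (I, \<theta>, r)))\<^sup>2)) * F (slice_polar (I, \<theta>, r)) * indicator nonreal (slice_polar (I, \<theta>, r)))
       \<partial>lborel \<partial>lborel \<partial>sphere_area)"
proof -
  let ?w = "\<lambda>(\<theta>, r). ennreal r * indicator ({0..2*pi} \<times> {0..}) (\<theta>, r)"
  have c[measurable]: "{0..2*pi} \<times> {0::real..} \<in> sets (borel :: (real\<times>real) measure)" by (intro borel_closed closed_Times) auto
  have [measurable]: "(\<lambda>x::real\<times>real. ennreal (snd x)) \<in> borel_measurable borel"
    by (intro measurable_compose[OF _ measurable_ennreal] borel_measurable_continuous_onI continuous_intros)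
  have w[measurable]: "?w \<in> borel_measurable (borel :: (real\<times>real) measure)"
    unfolding case_prod_beta by simp
  interpret D: sigma_finite_measure "density lborel ?w"
    using w
    by (subst sigma_finite_measure.sigma_finite_iff_density_finite[OF sigma_finite_lborel])
      (auto simp: ennreal_mult_eq_top_iff indicator_def split: prod.split simp del: of_bool_eq_1_iff)
  have s: "sets (sphere_area \<Otimes>\<^sub>M density lborel ?w) = sets (borel \<Otimes>\<^sub>M (borel \<Otimes>\<^sub>M borel))"
    by (intro sets_pair_measure_cong) (simp add: sets_sphere_area, subst borel_prod, simp)
  have sp[measurable]: "slice_polar \<in> borel_measurable (sphere_area \<Otimes>\<^sub>M density lborel ?w)"
    using measurable_slice_polar s by (simp cong: measurable_cong_sets)

  let ?G = "\<lambda>q. ennreal (exp (- (norm q)\<^sup>2)) * F q * indicator nonreal q"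
  have G[measurable]: "?G \<in> borel_measurable borel" using nonreal_borel by measurable
  have mP: "(\<lambda>z. slice_polar (I, z)) \<in> measurable (borel :: (real\<times>real) measure) borel" for I
    unfolding slice_polar_def slice_pt_def case_prod_beta fst_conv snd_conv
    by (intro borel_measurable_continuous_onI continuous_intros)
  have mG: "(\<lambda>z. ?w z * ?G (slice_polar (I, z))) \<in> borel_measurable (borel :: (real\<times>real) measure)" for I
    using measurable_compose[OF mP[of I] G] w by measurable
  have "(\<integral>\<^sup>+q. F q \<partial>gauss_slice_measure) = (\<integral>\<^sup>+q. ennreal (exp (- (norm q)\<^sup>2)) * F q \<partial>slice_measure)"
    unfolding gauss_slice_measure_def slice_measure_def
    by (intro nn_integral_density) (auto intro!: measurable_restrict_space1)
  also have "\<dots> = (\<integral>\<^sup>+z. ?G (slice_polar z) \<partial>(sphere_area \<Otimes>\<^sub>M density lborel ?w))"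
    unfolding slice_measure_def using nonreal_borel
    by (subst nn_integral_restrict_space) (simp_all add: nn_integral_distr[OF sp] G)
  also have "\<dots> = (\<integral>\<^sup>+I. \<integral>\<^sup>+z. ?G (slice_polar (I, z)) \<partial>density lborel ?w \<partial>sphere_area)"
    by (subst D.nn_integral_fst[symmetric]) (rule measurable_compose[OF sp G], simp)
  also have "\<dots> = (\<integral>\<^sup>+I. \<integral>\<^sup>+z. ?w z * ?G (slice_polar (I, z)) \<partial>lborel \<partial>sphere_area)"
    by (intro nn_integral_cong nn_integral_density) (use w measurable_compose[OF mP G] in simp_all)
  also have "\<dots> = (\<integral>\<^sup>+I. \<integral>\<^sup>+\<theta>. \<integral>\<^sup>+r. ?w (\<theta>, r) * ?G (slice_polar (I, \<theta>, r)) \<partial>lborel \<partial>lborel \<partial>sphere_area)"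
    by (intro nn_integral_cong, subst lborel_prod[symmetric], subst lborel.nn_integral_fst[symmetric])
      (use mG in \<open>simp_all add: lborel_prod\<close>)
  finally show ?thesis by (simp add: mult.assoc)
qed
definition L2_slice :: "(quat \<Rightarrow> quat) set"
  where "L2_slice = {f. f \<in> borel_measurable gauss_slice_measure \<and>
    integrable gauss_slice_measure (\<lambda>q. (norm (f q))\<^sup>2)}"

section \<open>The two spaces\<close>

definition fock_eigenspace :: "nat \<Rightarrow> (quat \<Rightarrow> quat) set"
  where "fock_eigenspace m = {f \<in> L2_slice \<inter> box_domain. \<forall>q\<in>nonreal. box f q = of_nat m * f q}"

definition fock_full :: "(quat \<Rightarrow> quat) set"
  where "fock_full = slice_regular nonreal \<inter> L2_slice"

end

theory Submission
  imports Defs "HOL-Complex_Analysis.Complex_Analysis" "HOL-Real_Asymp.Real_Asymp"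
begin

text \<open>
  On the slice \<open>\<complex>\<^sub>I\<close>, with \<open>\<partial> = (\<partial>\<^sub>x - I \<partial>\<^sub>y) / 2\<close> and \<open>\<partial>' = (\<partial>\<^sub>x + I \<partial>\<^sub>y) / 2\<close>, the
  operator factors as \<open>box = - \<partial> \<partial>' + cnj q \<partial>'\<close>. Slice regular functions satisfy \<open>\<partial>' f = 0\<close>
  and are smooth on each slice, so \<open>box f = 0\<close>; this is \<open>slice_regular_nonreal_box\<close>. The
  coordinates \<open>cpart\<close> of \<open>f\<close> on a slice reduce all statements on slices to statements about
  complex-valued functions.

  For the converse, \<open>box f = 0\<close> says that \<open>h = \<partial>' f\<close> satisfies \<open>\<partial> h = cnj z h\<close>, that is,
  \<open>e^(-\<bar>z\<bar>\<^sup>2) h\<close> is antiholomorphic on the half plane \<open>y > 0\<close>; write it as the conjugate of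
  a holomorphic \<open>\<kappa>\<close>. Nothing is known about \<open>f\<close> near the real line, so one cannot integrate
  by parts over the whole half plane. Instead, \<open>f\<close> being square integrable for the weight
  \<open>e^(-\<bar>z\<bar>\<^sup>2)\<close>, integration by parts against a bump function shows that local averages of
  \<open>z \<kappa>\<close> decay like a Gaussian away from the real line (\<open>norm_bump_average_le\<close>). A
  holomorphic function on a sector of opening \<open>2 pi / 3\<close> cannot decay that fast unless it is
  zero (\<open>Phragmen_Lindelof_half_strip\<close>), so the averages vanish, and \<open>\<kappa> = 0\<close>
  (\<open>strip_vanishing\<close>, \<open>half_plane_dbar_zero\<close>). The argument runs in logarithmic polar
  coordinates \<open>z = e^(s + \<i> \<theta>)\<close>: the measure is given in polar coordinates, the weight
  depends on \<open>s\<close> only, and averages of a holomorphic function over the translates of a fixed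
  square in \<open>(s, \<theta>)\<close> are holomorphic.

  Square integrability of \<open>f\<close> gives square integrability on almost every slice only. The
  good slices are dense (\<open>AE_sphere_area_dense\<close>), \<open>f\<close> is continuous since it is
  differentiable, and locally uniform limits of holomorphic functions are holomorphic; so
  \<open>\<partial>' f = 0\<close> on every slice (\<open>upper_dbar_zero\<close>).
\<close>

section \<open>Continuously differentiable functions of two real variables\<close>

text \<open>The total derivative, rather than the two partial ones, is recorded, so that the chain
  rule applies directly; for open \<open>D\<close> both carry the same information, since the partial
  derivatives are continuous.\<close>

definition C1_on :: "(real \<times> real) set \<Rightarrow> (real \<times> real \<Rightarrow> 'a::real_normed_vector)
    \<Rightarrow> (real \<times> real \<Rightarrow> 'a) \<Rightarrow> (real \<times> real \<Rightarrow> 'a) \<Rightarrow> bool"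
  where "C1_on D F Fx Fy \<longleftrightarrow>
    (\<forall>p\<in>D. (F has_derivative (\<lambda>h. fst h *\<^sub>R Fx p + snd h *\<^sub>R Fy p)) (at p)) \<and>
    continuous_on D Fx \<and> continuous_on D Fy"

lemma C1_onD:
  assumes "C1_on D F Fx Fy"
  shows "\<And>p. p \<in> D \<Longrightarrow> (F has_derivative (\<lambda>h. fst h *\<^sub>R Fx p + snd h *\<^sub>R Fy p)) (at p)"
    and "continuous_on D Fx" "continuous_on D Fy"
  using assms by (auto simp: C1_on_def)

lemma C1_onI_partials:
  fixes F :: "real \<times> real \<Rightarrow> 'a::real_normed_vector"
  assumes D: "open D"
    and Fx: "\<And>x y. (x, y) \<in> D \<Longrightarrow> ((\<lambda>t. F (t, y)) has_vector_derivative Fx (x, y)) (at x)"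
    and Fy: "\<And>x y. (x, y) \<in> D \<Longrightarrow> ((\<lambda>t. F (x, t)) has_vector_derivative Fy (x, y)) (at y)"
    and cont: "continuous_on D Fx" "continuous_on D Fy"
  shows "C1_on D F Fx Fy"
  unfolding C1_on_def
proof (intro conjI ballI cont)
  fix p assume p: "p \<in> D"
  obtain x y where xy: "p = (x, y)" by (cases p)
  obtain A B where AB: "open A" "open B" "p \<in> A \<times> B" "A \<times> B \<subseteq> D"
    using open_prod_elim[OF D p] by metis
  obtain e where e: "e > 0" "ball y e \<subseteq> B"
    using AB(2,3) xy open_contains_ball[of B] by auto
  have sub: "A \<times> ball y e \<subseteq> D" using AB e by auto
  have mem: "x \<in> A" "y \<in> ball y e" using AB xy e by auto
  have op: "open (A \<times> ball y e)" using AB by (simp add: open_Times)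
  have "((\<lambda>(x, y). F (x, y)) has_derivative
      (\<lambda>(tx, ty). tx *\<^sub>R Fx (x, y) + blinfun_scaleR_left (Fy (x, y)) ty)) (at (x, y) within A \<times> ball y e)"
  proof (rule has_derivative_partialsI)
    show "((\<lambda>x. F (x, y)) has_derivative (\<lambda>h. h *\<^sub>R Fx (x, y))) (at x within A)"
      using Fx[of x y] p xy by (simp add: has_vector_derivative_def has_derivative_at_withinI)
  next
    fix x' y' assume "x' \<in> A" "y' \<in> ball y e"
    then show "((\<lambda>y. F (x', y)) has_derivative blinfun_apply (blinfun_scaleR_left (Fy (x', y'))))
        (at y' within ball y e)"
      using Fy[of x' y'] sub
      by (auto simp: has_vector_derivative_def blinfun_scaleR_left.rep_eq subset_iff
          intro: has_derivative_at_withinI[where s="ball y e"])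
  next
    have "continuous_on (A \<times> ball y e) (\<lambda>z. blinfun_scaleR_left (Fy z))"
      by (intro continuous_intros bounded_linear.continuous_on[OF bounded_linear_blinfun_scaleR_left]
          continuous_on_subset[OF cont(2) sub])
    then show "continuous (at (x, y) within A \<times> ball y e) (\<lambda>(x, y). blinfun_scaleR_left (Fy (x, y)))"
      using mem by (simp add: continuous_on_eq_continuous_within case_prod_unfold)
  qed (use mem in auto)
  then show "(F has_derivative (\<lambda>h. fst h *\<^sub>R Fx p + snd h *\<^sub>R Fy p)) (at p)"
    using mem unfolding at_within_open[OF SigmaI[OF mem] op] xy
    by (simp add: case_prod_unfold blinfun_scaleR_left.rep_eq)
qed

lemma C1_on_imp_continuous_on:
  "C1_on D F Fx Fy \<Longrightarrow> continuous_on D F"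
  by (rule continuous_at_imp_continuous_on) (auto intro: has_derivative_continuous dest: C1_onD(1))

lemma C1_on_subset: "C1_on D F Fx Fy \<Longrightarrow> E \<subseteq> D \<Longrightarrow> C1_on E F Fx Fy"
  unfolding C1_on_def by (auto intro: continuous_on_subset)

lemma C1_on_bounded_linear:
  assumes "C1_on D F Fx Fy" and L: "bounded_linear L"
  shows "C1_on D (\<lambda>p. L (F p)) (\<lambda>p. L (Fx p)) (\<lambda>p. L (Fy p))"
proof -
  interpret bounded_linear L by fact
  have "((\<lambda>p. L (F p)) has_derivative (\<lambda>h. fst h *\<^sub>R L (Fx p) + snd h *\<^sub>R L (Fy p))) (at p)"
    if "p \<in> D" for p
    using has_derivative[OF C1_onD(1)[OF assms(1) that]] by (simp add: add scaleR)
  then show ?thesis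
    using continuous_on[OF C1_onD(2)[OF assms(1)]] continuous_on[OF C1_onD(3)[OF assms(1)]]
    by (simp add: C1_on_def)
qed

lemma C1_on_diff:
  assumes "C1_on D F Fx Fy" "C1_on D G Gx Gy"
  shows "C1_on D (\<lambda>p. F p - G p) (\<lambda>p. Fx p - Gx p) (\<lambda>p. Fy p - Gy p)"
proof -
  have "((\<lambda>p. F p - G p) has_derivative (\<lambda>h. fst h *\<^sub>R (Fx p - Gx p) + snd h *\<^sub>R (Fy p - Gy p))) (at p)"
    if "p \<in> D" for p
    using has_derivative_diff[OF C1_onD(1)[OF assms(1) that] C1_onD(1)[OF assms(2) that]]
    by (simp add: algebra_simps)
  then show ?thesis
    using C1_onD(2,3)[OF assms(1)] C1_onD(2,3)[OF assms(2)] unfolding C1_on_def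
    by (auto intro!: continuous_on_diff)
qed

lemma C1_on_cong:
  assumes C: "C1_on D F Fx Fy" and D: "open D" and eq: "\<And>p. p \<in> D \<Longrightarrow> G p = F p"
  shows "C1_on D G Fx Fy"
  using C has_derivative_transform_within_open[OF C1_onD(1)[OF C] D] eq
  unfolding C1_on_def by (auto simp del: split_paired_All)

lemma C1_on_compose_path:
  assumes "C1_on D F Fx Fy" "(a t, b t) \<in> D"
    "(a has_real_derivative a') (at t)" "(b has_real_derivative b') (at t)"
  shows "((\<lambda>t. F (a t, b t)) has_vector_derivative a' *\<^sub>R Fx (a t, b t) + b' *\<^sub>R Fy (a t, b t)) (at t)"
proof -
  have "((\<lambda>t. (a t, b t)) has_derivative (\<lambda>h. (a' * h, b' * h))) (at t)"
    using assms(3,4) by (intro has_derivative_Pair) (auto simp: has_field_derivative_def)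
  from has_derivative_compose[OF this C1_onD(1)[OF assms(1,2)]]
  show ?thesis by (simp add: has_vector_derivative_def algebra_simps)
qed

lemma C1_on_partials:
  assumes "C1_on D F Fx Fy" "(x, y) \<in> D"
  shows "((\<lambda>t. F (t, y)) has_vector_derivative Fx (x, y)) (at x)"
    and "((\<lambda>t. F (x, t)) has_vector_derivative Fy (x, y)) (at y)"
  using C1_on_compose_path[OF assms(1), of "\<lambda>t. t" x "\<lambda>_. y" 1 0]
    C1_on_compose_path[OF assms(1), of "\<lambda>_. x" y "\<lambda>t. t" 0 1] assms(2)
  by simp_all

text \<open>Under the Cauchy--Riemann equation \<open>F\<^sub>y = \<i> F\<^sub>x\<close> the real-linear derivative
  \<open>h \<mapsto> Re h F\<^sub>x + Im h F\<^sub>y\<close> is multiplication by \<open>F\<^sub>x\<close>.\<close>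

lemma C1_on_Cauchy_Riemann:
  assumes F: "C1_on D F Fx Fy" and CR: "Fx (Re z, Im z) + \<i> * Fy (Re z, Im z) = 0"
    and z: "(Re z, Im z) \<in> D"
  shows "((\<lambda>z. F (Re z, Im z)) has_field_derivative Fx (Re z, Im z)) (at z)"
proof -
  have *: "((\<lambda>z. (Re z, Im z)) has_derivative (\<lambda>h. (Re h, Im h))) (at z)"
    by (intro has_derivative_Pair bounded_linear_imp_has_derivative bounded_linear_Re bounded_linear_Im)
  have "Fy (Re z, Im z) = \<i> * Fx (Re z, Im z)"
    using CR by (metis (no_types, lifting) add.inverse_inverse add_eq_0_iff2 i_times_eq_iff mult_minus_right)
  then have "(\<lambda>h. Re h *\<^sub>R Fx (Re z, Im z) + Im h *\<^sub>R Fy (Re z, Im z)) = (*) (Fx (Re z, Im z))"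
    by (auto simp: fun_eq_iff complex_eq_iff)
  then show ?thesis
    using has_derivative_compose[OF * C1_onD(1)[OF F z]]
    by (simp add: has_field_derivative_def)
qed

lemma integral_cbox_partial1:
  fixes Q Qx :: "real \<times> real \<Rightarrow> 'a::banach"
  assumes "a \<le> b" and c: "continuous_on (cbox (a, c) (b, d)) Qx"
    and Q: "\<And>x y. x \<in> {a..b} \<Longrightarrow> y \<in> {c..d} \<Longrightarrow>
      ((\<lambda>t. Q (t, y)) has_vector_derivative Qx (x, y)) (at x)"
  shows "integral (cbox (a, c) (b, d)) Qx = integral {c..d} (\<lambda>y. Q (b, y) - Q (a, y))"
proof -
  have "integral (cbox (a, c) (b, d)) Qx = integral {a..b} (\<lambda>x. integral {c..d} (\<lambda>y. Qx (x, y)))"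
    using integral_prod_continuous[OF c] by simp
  also have "\<dots> = integral {c..d} (\<lambda>y. integral {a..b} (\<lambda>x. Qx (x, y)))"
    using integral_swap_continuous[of a c b d "\<lambda>x y. Qx (x, y)"] c by simp
  also have "\<dots> = integral {c..d} (\<lambda>y. Q (b, y) - Q (a, y))"
    using assms
    by (intro integral_cong integral_unique
        fundamental_theorem_of_calculus[OF _ has_vector_derivative_at_within[OF Q]]) auto
  finally show ?thesis .
qed

lemma integral_cbox_partial2:
  fixes Q Qy :: "real \<times> real \<Rightarrow> 'a::banach"
  assumes "c \<le> d" and c: "continuous_on (cbox (a, c) (b, d)) Qy"
    and Q: "\<And>x y. x \<in> {a..b} \<Longrightarrow> y \<in> {c..d} \<Longrightarrow>
      ((\<lambda>t. Q (x, t)) has_vector_derivative Qy (x, y)) (at y)"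
  shows "integral (cbox (a, c) (b, d)) Qy = integral {a..b} (\<lambda>x. Q (x, d) - Q (x, c))"
proof -
  have "integral (cbox (a, c) (b, d)) Qy = integral {a..b} (\<lambda>x. integral {c..d} (\<lambda>y. Qy (x, y)))"
    using integral_prod_continuous[OF c] by simp
  also have "\<dots> = integral {a..b} (\<lambda>x. Q (x, d) - Q (x, c))"
    using assms
    by (intro integral_cong integral_unique
        fundamental_theorem_of_calculus[OF _ has_vector_derivative_at_within[OF Q]]) auto
  finally show ?thesis .
qed

text \<open>If \<open>\<phi> (a, b)\<close> were non-zero, then \<open>\<phi>\<close> would have a positive component in the direction
  of \<open>\<phi> (a, b)\<close> on a small square around the point, and so would its average. The weight is
  free, because it is \<open>1\<close> for the symmetry of mixed partial derivatives and a bump function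
  for the vanishing of a holomorphic function.\<close>

lemma zero_if_averages_zero:
  fixes \<phi> :: "real \<times> real \<Rightarrow> 'a::euclidean_space" and W :: "real \<Rightarrow> real \<times> real \<Rightarrow> real"
  assumes r: "r > 0"
    and c: "continuous_on (cbox (a - r, b - r) (a + r, b + r)) \<phi>"
    and W: "\<And>\<delta>. 0 < \<delta> \<Longrightarrow> \<delta> < r \<Longrightarrow> continuous_on UNIV (W \<delta>)"
      "\<And>\<delta> q. 0 < \<delta> \<Longrightarrow> \<delta> < r \<Longrightarrow> q \<in> cbox (a - \<delta>, b - \<delta>) (a + \<delta>, b + \<delta>) \<Longrightarrow> W \<delta> q \<ge> 0"
      "\<And>\<delta>. 0 < \<delta> \<Longrightarrow> \<delta> < r \<Longrightarrow> W \<delta> (a, b) > 0"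
    and I: "\<And>\<delta>. 0 < \<delta> \<Longrightarrow> \<delta> < r \<Longrightarrow>
       integral (cbox (a - \<delta>, b - \<delta>) (a + \<delta>, b + \<delta>)) (\<lambda>q. W \<delta> q *\<^sub>R \<phi> q) = 0"
  shows "\<phi> (a, b) = 0"
proof (rule ccontr)
  assume nz: "\<phi> (a, b) \<noteq> 0"
  define v where "v = \<phi> (a, b)"
  have "((\<lambda>q. inner v (\<phi> q)) \<longlongrightarrow> inner v v) (at (a, b) within cbox (a - r, b - r) (a + r, b + r))"
    unfolding v_def using c r by (intro tendsto_intros) (auto simp: continuous_on_def)
  moreover have "inner v v > 0" using nz by (simp add: v_def)
  ultimately have "\<forall>\<^sub>F q in at (a, b) within cbox (a - r, b - r) (a + r, b + r). inner v (\<phi> q) > 0"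
    by (rule order_tendstoD)
  then obtain d where d: "d > 0"
    and pos: "\<And>q. q \<in> cbox (a - r, b - r) (a + r, b + r) \<Longrightarrow> q \<noteq> (a, b) \<Longrightarrow> dist q (a, b) < d
      \<Longrightarrow> inner v (\<phi> q) > 0"
    unfolding eventually_at by blast
  define \<delta> where "\<delta> = min r d / 3"
  have \<delta>': "0 < \<delta>" "\<delta> < r" "3 * \<delta> \<le> d" using d r by (auto simp: \<delta>_def)
  let ?Q = "cbox (a - \<delta>, b - \<delta>) (a + \<delta>, b + \<delta>)"
  have sub: "?Q \<subseteq> cbox (a - r, b - r) (a + r, b + r)"
    using \<delta>' by (auto simp: cbox_Pair_eq)
  have pos': "inner v (\<phi> q) \<ge> 0" if q: "q \<in> ?Q" for q
  proof (cases "q = (a, b)")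
    case True then show ?thesis by (simp add: v_def)
  next
    case False
    obtain x y where xy: "q = (x, y)" by (cases q)
    have "dist q (a, b) \<le> \<bar>x - a\<bar> + \<bar>y - b\<bar>"
      unfolding xy dist_Pair_Pair dist_real_def by (rule sqrt_sum_squares_le_sum_abs[THEN order_trans]) simp
    also have "\<dots> < d" using q \<delta>' by (auto simp: xy cbox_Pair_eq)
    finally show ?thesis using pos[of q] False q sub by (auto intro: less_imp_le)
  qed
  have cW: "continuous_on ?Q (\<lambda>q. W \<delta> q *\<^sub>R \<phi> q)"
    by (intro continuous_intros continuous_on_subset[OF c sub]
        continuous_on_subset[OF W(1)[OF \<delta>'(1,2)]]) auto
  have "integral ?Q (\<lambda>q. inner v (W \<delta> q *\<^sub>R \<phi> q)) = inner v (integral ?Q (\<lambda>q. W \<delta> q *\<^sub>R \<phi> q))"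
    using integral_linear[OF integrable_continuous[OF cW] bounded_linear_inner_right[of v]]
    by (simp add: o_def)
  also have "\<dots> = 0" using I[OF \<delta>'(1,2)] by simp
  finally have "integral ?Q (\<lambda>q. inner v (W \<delta> q *\<^sub>R \<phi> q)) = 0" .
  moreover have "Topology_Euclidean_Space.box (a - \<delta>, b - \<delta>) (a + \<delta>, b + \<delta>) \<noteq> {}"
    using \<delta>' by (auto simp: box_ne_empty Basis_prod_def)
  moreover have "continuous_on ?Q (\<lambda>q. inner v (W \<delta> q *\<^sub>R \<phi> q))"
    by (intro continuous_intros cW)
  moreover have "inner v (W \<delta> q *\<^sub>R \<phi> q) \<ge> 0" if "q \<in> ?Q" for q
    using pos'[OF that] W(2)[OF \<delta>'(1,2) that] by simp
  ultimately have "\<forall>q\<in>?Q. inner v (W \<delta> q *\<^sub>R \<phi> q) = 0"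
    using integral_cbox_eq_0_iff[of "(a - \<delta>, b - \<delta>)" "(a + \<delta>, b + \<delta>)"
        "\<lambda>q. inner v (W \<delta> q *\<^sub>R \<phi> q)"] by (metis (no_types, lifting))
  moreover have "(a, b) \<in> ?Q" using \<delta>' by (auto simp: cbox_Pair_eq)
  ultimately have "inner v (W \<delta> (a, b) *\<^sub>R \<phi> (a, b)) = 0" by (rule bspec)
  then show False using W(3)[OF \<delta>'(1,2)] nz by (simp add: v_def)
qed

text \<open>Both mixed derivatives have the same integral over every rectangle, namely the
  alternating sum of the values of \<open>F\<close> at the four corners.\<close>

lemma mixed_partials_eq:
  fixes F :: "real \<times> real \<Rightarrow> 'a::euclidean_space"
  assumes D: "open D" and F: "C1_on D F Fx Fy" and Fx: "C1_on D Fx Fxx Fxy"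
    and Fy: "C1_on D Fy Fyx Fyy" and p: "p \<in> D"
  shows "Fxy p = Fyx p"
proof -
  obtain a b where ab: "p = (a, b)" by (cases p)
  obtain A B where AB: "open A" "open B" "p \<in> A \<times> B" "A \<times> B \<subseteq> D"
    using open_prod_elim[OF D p] by metis
  obtain e1 e2 where e: "e1 > 0" "cball a e1 \<subseteq> A" "e2 > 0" "cball b e2 \<subseteq> B"
    using AB ab by (metis SigmaD1 SigmaD2 open_contains_cball)
  define r where "r = min e1 e2"
  have r: "r > 0" using e by (simp add: r_def)
  have sub: "cbox (a - r, b - r) (a + r, b + r) \<subseteq> D"
    using e AB(4) by (fastforce simp: r_def cbox_Pair_eq cball_eq_atLeastAtMost)
  have "(Fxy (a, b) - Fyx (a, b)) = 0"
  proof (rule zero_if_averages_zero[where W="\<lambda>_ _. 1" and \<phi>="\<lambda>q. Fxy q - Fyx q", OF r])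
    show "continuous_on (cbox (a - r, b - r) (a + r, b + r)) (\<lambda>q. Fxy q - Fyx q)"
      by (intro continuous_on_diff continuous_on_subset[OF C1_onD(3)[OF Fx] sub]
          continuous_on_subset[OF C1_onD(2)[OF Fy] sub])
  next
    fix \<delta> assume \<delta>: "0 < \<delta>" "\<delta> < r"
    let ?Q = "cbox (a - \<delta>, b - \<delta>) (a + \<delta>, b + \<delta>)"
    have sub': "?Q \<subseteq> D"
      using \<delta> by (intro order_trans[OF _ sub]) (auto simp: cbox_Pair_eq)
    have mem: "(x, y) \<in> D" if "x \<in> {a - \<delta>..a + \<delta>}" "y \<in> {b - \<delta>..b + \<delta>}" for x y
      using sub' that by (auto simp: cbox_Pair_eq)
    have c: "continuous_on ?Q Fxy" "continuous_on ?Q Fyx" "continuous_on D Fx" "continuous_on D Fy"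
      by (rule continuous_on_subset[OF C1_onD(3)[OF Fx] sub']
          continuous_on_subset[OF C1_onD(2)[OF Fy] sub']
          C1_on_imp_continuous_on[OF Fx] C1_on_imp_continuous_on[OF Fy])+
    have i: "(\<lambda>x. Fx (x, t)) integrable_on {a - \<delta>..a + \<delta>}" if "t \<in> {b - \<delta>..b + \<delta>}" for t
      by (rule integrable_continuous_real, rule continuous_on_compose2[OF c(3)])
        (use that mem in \<open>auto intro!: continuous_intros\<close>)
    have j: "(\<lambda>y. Fy (t, y)) integrable_on {b - \<delta>..b + \<delta>}" if "t \<in> {a - \<delta>..a + \<delta>}" for t
      by (rule integrable_continuous_real, rule continuous_on_compose2[OF c(4)])
        (use that mem in \<open>auto intro!: continuous_intros\<close>)
    have "integral ?Q Fxy = integral {a - \<delta>..a + \<delta>} (\<lambda>x. Fx (x, b + \<delta>) - Fx (x, b - \<delta>))"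
      using \<delta> by (intro integral_cbox_partial2 c) (auto intro!: C1_on_partials(2)[OF Fx] mem)
    also have "\<dots> = integral {a - \<delta>..a + \<delta>} (\<lambda>x. Fx (x, b + \<delta>)) - integral {a - \<delta>..a + \<delta>} (\<lambda>x. Fx (x, b - \<delta>))"
      using \<delta> by (intro integral_diff i) auto
    also have "integral {a - \<delta>..a + \<delta>} (\<lambda>x. Fx (x, b + \<delta>)) = F (a + \<delta>, b + \<delta>) - F (a - \<delta>, b + \<delta>)"
      using \<delta> by (intro integral_unique fundamental_theorem_of_calculus
        has_vector_derivative_at_within[OF C1_on_partials(1)[OF F]] mem) auto
    also have "integral {a - \<delta>..a + \<delta>} (\<lambda>x. Fx (x, b - \<delta>)) = F (a + \<delta>, b - \<delta>) - F (a - \<delta>, b - \<delta>)"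
      using \<delta> by (intro integral_unique fundamental_theorem_of_calculus
        has_vector_derivative_at_within[OF C1_on_partials(1)[OF F]] mem) auto
    finally have 1: "integral ?Q Fxy = F (a + \<delta>, b + \<delta>) - F (a - \<delta>, b + \<delta>) - (F (a + \<delta>, b - \<delta>) - F (a - \<delta>, b - \<delta>))" .
    have "integral ?Q Fyx = integral {b - \<delta>..b + \<delta>} (\<lambda>y. Fy (a + \<delta>, y) - Fy (a - \<delta>, y))"
      using \<delta> by (intro integral_cbox_partial1 c) (auto intro!: C1_on_partials(1)[OF Fy] mem)
    also have "\<dots> = integral {b - \<delta>..b + \<delta>} (\<lambda>y. Fy (a + \<delta>, y)) - integral {b - \<delta>..b + \<delta>} (\<lambda>y. Fy (a - \<delta>, y))"
      using \<delta> by (intro integral_diff j) auto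
    also have "integral {b - \<delta>..b + \<delta>} (\<lambda>y. Fy (a + \<delta>, y)) = F (a + \<delta>, b + \<delta>) - F (a + \<delta>, b - \<delta>)"
      using \<delta> by (intro integral_unique fundamental_theorem_of_calculus
        has_vector_derivative_at_within[OF C1_on_partials(2)[OF F]] mem) auto
    also have "integral {b - \<delta>..b + \<delta>} (\<lambda>y. Fy (a - \<delta>, y)) = F (a - \<delta>, b + \<delta>) - F (a - \<delta>, b - \<delta>)"
      using \<delta> by (intro integral_unique fundamental_theorem_of_calculus
        has_vector_derivative_at_within[OF C1_on_partials(2)[OF F]] mem) auto
    finally have "integral ?Q Fyx = integral ?Q Fxy" using 1 by simp
    then show "integral ?Q (\<lambda>q. 1 *\<^sub>R (Fxy q - Fyx q)) = 0"
      using c by (simp add: integral_diff integrable_continuous)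
  qed auto
  then show ?thesis by (simp add: ab)
qed

section \<open>A uniqueness theorem of Phragmen--Lindelof type\<close>

text \<open>A half-strip of width \<open>2 pi / 3\<close> admits the comparison function
  \<open>exp (N exp (3/2 (w - \<i> pi / 2)))\<close>: its modulus is \<open>1\<close> on the two horizontal edges, where
  the angle \<open>3/2 (Im w - pi / 2)\<close> is \<open>\<plusminus> pi / 2\<close>, at most \<open>exp N\<close> on the vertical edge, and
  \<open>exp (N exp (3/2 s))\<close> on the centre line. As \<open>3/2 < 2\<close>, the decay of \<open>K\<close> beats its growth,
  so the maximum principle applies, and \<open>N \<rightarrow> \<infinity>\<close> forces \<open>K\<close> to vanish on the centre line.\<close>

lemma Phragmen_Lindelof_half_strip:
  fixes K :: "complex \<Rightarrow> complex"
  assumes holo: "K holomorphic_on U" and U: "open U"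
    and sub: "\<And>w. 0 \<le> Re w \<Longrightarrow> \<bar>Im w - pi / 2\<bar> \<le> pi / 3 \<Longrightarrow> w \<in> U"
    and A: "0 \<le> A" and c: "0 < c"
    and bound: "\<And>w. 0 \<le> Re w \<Longrightarrow> \<bar>Im w - pi / 2\<bar> \<le> pi / 3 \<Longrightarrow>
      norm (K w) \<le> A * exp (- c * exp (2 * Re w))"
    and s: "0 < s"
  shows "K (Complex s (pi / 2)) = 0"
proof -
  define P where "P N w = K w * exp (of_real N * exp (of_real (3/2) * (w - \<i> * of_real (pi/2))))"
    for N :: real and w
  have norm_P: "norm (P N w) = norm (K w) * exp (N * (exp (3/2 * Re w) * cos (3/2 * (Im w - pi/2))))" for N w
    by (simp add: P_def norm_mult Re_exp algebra_simps)
  have bd: "norm (K (Complex s (pi / 2))) \<le> A * exp (N * (1 - exp (3/2 * s)))" if N: "N > 0" for N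
  proof -
    \<comment> \<open>Beyond some \<open>R\<close> the decay of \<open>K\<close> outweighs the comparison function, uniformly on the right edge.\<close>
    have "filterlim (\<lambda>R::real. N * exp (3/2 * R) - c * exp (2 * R)) at_bot at_top"
      using N c by real_asymp
    then have "\<forall>\<^sub>F R in at_top. N * exp (3/2 * R) - c * exp (2 * R) \<le> 0"
      unfolding filterlim_at_bot by (rule spec)
    then have "\<forall>\<^sub>F R in at_top. N * exp (3/2 * R) - c * exp (2 * R) \<le> 0 \<and> R > s"
      by (intro eventually_conj eventually_gt_at_top)
    then obtain R where R: "N * exp (3/2 * R) \<le> c * exp (2 * R)" "R > s"
      by (auto simp: eventually_at_top_linorder)
    define S where "S = cbox (Complex 0 (pi/2 - pi/3)) (Complex R (pi/2 + pi/3))"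
    have S: "w \<in> S \<longleftrightarrow> 0 \<le> Re w \<and> Re w \<le> R \<and> \<bar>Im w - pi/2\<bar> \<le> pi/3" for w
      by (auto simp: S_def in_cbox_complex_iff abs_if)
    have iS: "interior S = {w. 0 < Re w \<and> Re w < R \<and> \<bar>Im w - pi/2\<bar> < pi/3}"
      by (auto simp: S_def in_box_complex_iff abs_if split: if_splits)
    have SU: "S \<subseteq> U" using sub by (auto simp: S)
    have "norm (P N (Complex s (pi/2))) \<le> A * exp N"
    proof (rule maximum_modulus_frontier[of "P N" S])
      have PU: "P N holomorphic_on U"
        unfolding P_def by (intro holomorphic_intros holo)
      show "P N holomorphic_on interior S"
        using PU SU interior_subset by (blast intro: holomorphic_on_subset)
      show "continuous_on (closure S) (P N)"
        using PU SU by (auto simp: S_def intro: holomorphic_on_imp_continuous_on holomorphic_on_subset)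
      show "bounded S" by (simp add: S_def)
      show "Complex s (pi / 2) \<in> S" using s R by (simp add: S)
    next
      fix w assume "w \<in> frontier S"
      then have w: "w \<in> S" and "w \<notin> interior S"
        by (auto simp: frontier_def S_def)
      then consider "Re w = 0" | "Re w = R" | "\<bar>Im w - pi/2\<bar> = pi/3"
        by (auto simp: S iS)
      then have "- c * exp (2 * Re w) + N * (exp (3/2 * Re w) * cos (3/2 * (Im w - pi/2))) \<le> N"
      proof cases
        case 1
        have "N * cos (3/2 * (Im w - pi/2)) \<le> N * 1"
          using N by (intro mult_left_mono) auto
        then show ?thesis using 1 c by simp
      next
        case 2
        have "N * (exp (3/2 * R) * cos (3/2 * (Im w - pi/2))) \<le> N * (exp (3/2 * R) * 1)"
          using N by (intro mult_left_mono) auto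
        then show ?thesis unfolding 2 using R(1) N by linarith
      next
        case 3
        then have "3/2 * (Im w - pi/2) = pi/2 \<or> 3/2 * (Im w - pi/2) = - (pi/2)"
          by (auto simp: abs_if field_simps split: if_splits)
        then have "cos (3/2 * (Im w - pi/2)) = 0"
          by (metis cos_minus cos_pi_half)
        moreover have "c * exp (2 * Re w) \<ge> 0" using c by simp
        ultimately show ?thesis using N by simp
      qed
      moreover have "norm (P N w) \<le> A * exp (- c * exp (2 * Re w)) *
          exp (N * (exp (3/2 * Re w) * cos (3/2 * (Im w - pi/2))))"
        unfolding norm_P using bound[of w] w by (intro mult_right_mono) (auto simp: S)
      ultimately show "norm (P N w) \<le> A * exp N"
        by (smt (verit, best) A exp_add exp_le_cancel_iff mult.assoc mult_left_mono)
    qed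
    then show ?thesis
      unfolding norm_P by (simp add: exp_diff exp_minus field_simps right_diff_distrib)
  qed
  have "((\<lambda>N. A * exp (N * (1 - exp (3/2 * s)))) \<longlongrightarrow> A * 0) at_top"
  proof (intro tendsto_intros filterlim_compose[OF exp_at_bot])
    have "1 - exp (3/2 * s) < 0" using s by simp
    then show "filterlim (\<lambda>N. N * (1 - exp (3/2 * s))) at_bot at_top"
      by real_asymp
  qed
  then have "norm (K (Complex s (pi / 2))) \<le> A * 0"
    by (rule tendsto_lowerbound[OF _ eventually_mono[OF eventually_gt_at_top[of 0] bd]]) simp_all
  then show ?thesis by simp
qed

section \<open>Weighted averages in logarithmic polar coordinates\<close>

text \<open>Vanishing on the boundary of the square is all that integration by parts needs, so a
  polynomial serves as cut-off.\<close>

definition bump :: "real \<Rightarrow> real \<times> real \<Rightarrow> real"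
  where "bump \<delta> q = (\<delta>\<^sup>2 - (fst q)\<^sup>2) * (\<delta>\<^sup>2 - (snd q)\<^sup>2)"

definition bump_average :: "real \<Rightarrow> (complex \<Rightarrow> complex) \<Rightarrow> complex \<Rightarrow> complex"
  where "bump_average \<delta> H w = integral (cbox (- \<delta>, - \<delta>) (\<delta>, \<delta>))
    (\<lambda>q. bump \<delta> q *\<^sub>R H (w + Complex (fst q) (snd q)))"

lemma continuous_on_bump [continuous_intros]:
  "continuous_on S f \<Longrightarrow> continuous_on S (\<lambda>x. bump \<delta> (f x))"
  unfolding bump_def by (intro continuous_intros)

lemma continuous_on_Complex [continuous_intros]:
  "continuous_on S f \<Longrightarrow> continuous_on S g \<Longrightarrow> continuous_on S (\<lambda>x. Complex (f x) (g x))"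
  unfolding Complex_eq by (intro continuous_intros)

lemma holomorphic_bump_average:
  assumes H: "H holomorphic_on {w. 0 < Im w \<and> Im w < pi}" and \<delta>: "0 < \<delta>"
  shows "bump_average \<delta> H holomorphic_on {w. \<delta> < Im w \<and> Im w < pi - \<delta>}"
  unfolding bump_average_def
proof (rule leibniz_rule_holomorphic)
  let ?T = "{w. 0 < Im w \<and> Im w < pi}" and ?U = "{w. \<delta> < Im w \<and> Im w < pi - \<delta>}"
  let ?Q = "cbox (- \<delta>, - \<delta>) (\<delta>, \<delta>)"
  have T: "open ?T"
    by (intro open_Collect_conj open_Collect_less continuous_intros)
  have mem: "w + Complex (fst q) (snd q) \<in> ?T" if "w \<in> ?U" "q \<in> ?Q" for w q
    using that by (cases q) (auto simp: cbox_Pair_eq)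
  show "((\<lambda>w. bump \<delta> q *\<^sub>R H (w + Complex (fst q) (snd q))) has_field_derivative
      bump \<delta> q *\<^sub>R deriv H (w + Complex (fst q) (snd q))) (at w within ?U)"
    if "w \<in> ?U" "q \<in> ?Q" for w q
  proof -
    have "(H has_field_derivative deriv H (w + Complex (fst q) (snd q))) (at (w + Complex (fst q) (snd q)))"
      by (rule holomorphic_derivI[OF H T mem[OF that]])
    then have "((\<lambda>w. H (w + Complex (fst q) (snd q))) has_field_derivative
        deriv H (w + Complex (fst q) (snd q))) (at w)"
      by (simp only: DERIV_shift)
    from has_field_derivative_at_within[OF DERIV_cmult[OF this]] show ?thesis
      unfolding scaleR_conv_of_real .
  qed
  show "(\<lambda>q. bump \<delta> q *\<^sub>R H (w + Complex (fst q) (snd q))) integrable_on ?Q" if "w \<in> ?U" for w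
  proof (intro integrable_continuous continuous_intros)
    show "continuous_on ?Q (\<lambda>q. H (w + Complex (fst q) (snd q)))"
      by (rule continuous_on_compose2[OF holomorphic_on_imp_continuous_on[OF H]])
        (use mem that in \<open>auto intro!: continuous_intros\<close>)
  qed
  have "continuous_on (?U \<times> ?Q) (\<lambda>p. bump \<delta> (snd p) *\<^sub>R deriv H (fst p + Complex (fst (snd p)) (snd (snd p))))"
  proof (intro continuous_intros)
    show "continuous_on (?U \<times> ?Q) (\<lambda>p. deriv H (fst p + Complex (fst (snd p)) (snd (snd p))))"
      by (rule continuous_on_compose2[OF holomorphic_on_imp_continuous_on[OF holomorphic_deriv[OF H T]]])
        (use mem in \<open>auto intro!: continuous_intros\<close>)
  qed
  then show "continuous_on (?U \<times> ?Q) (\<lambda>(w, q). bump \<delta> q *\<^sub>R deriv H (w + Complex (fst q) (snd q)))"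
    by (simp add: case_prod_unfold)
  have "?U = {w. \<delta> < Im w} \<inter> {w. Im w < pi - \<delta>}" by auto
  then show "convex ?U"
    by (simp add: convex_Int convex_halfspace_Im_gt convex_halfspace_Im_lt)
qed

text \<open>The image of the upper half plane under the logarithm, in the coordinates \<open>s = ln r\<close>
  and \<open>\<theta>\<close>. In these coordinates the Gaussian weight depends on \<open>s\<close> only.\<close>

definition strip :: "(real \<times> real) set"
  where "strip = UNIV \<times> {0<..<pi}"

text \<open>The density \<open>\<bar>\<Psi>\<bar>\<^sup>2 e^(-r\<^sup>2) r dr d\<theta>\<close> at \<open>r = e^s\<close>; one of the two factors \<open>e^s\<close> in
  \<open>exp (2 * s)\<close> is the Jacobian \<open>dr = e^s ds\<close>.\<close>

definition log_polar_density :: "(real \<times> real \<Rightarrow> complex) \<Rightarrow> real \<times> real \<Rightarrow> real"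
  where "log_polar_density \<Psi> p =
    (norm (\<Psi> p))\<^sup>2 * exp (- exp (2 * fst p)) * exp (2 * fst p)"

text \<open>With \<open>x = r\<^sup>2\<close> and \<open>t\<close> the modulus of a function, this bounds a weighted \<open>L\<^sup>1\<close> density
  by the \<open>L\<^sup>2\<close> density while keeping a factor \<open>e^(-x/4)\<close>. It rests on \<open>y \<le> 1 + y\<^sup>2\<close>, which
  replaces the Cauchy--Schwarz inequality.\<close>

lemma weighted_norm_le:
  fixes x t :: real
  assumes "x > 0" "t \<ge> 0"
  shows "x * exp (- x) * t \<le> exp (- x / 4) * (4 + t\<^sup>2 * exp (- x) * x)"
proof -
  define e where "e = exp (- x / 4)"
  have e: "0 < e" "e \<le> 1" using assms by (auto simp: e_def)
  have e4: "exp (- x) = e ^ 4" by (simp add: e_def flip: exp_of_nat_mult)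
  have "x / 4 \<le> exp (x / 4)" using exp_ge_add_one_self[of "x / 4"] by linarith
  then have "x / 4 * e \<le> exp (x / 4) * e" using e by (intro mult_right_mono) auto
  also have "\<dots> = 1" by (simp add: e_def flip: exp_add)
  finally have xe: "x * e \<le> 4" by simp
  have "0 \<le> (e\<^sup>2 * t - 1)\<^sup>2" "0 \<le> e\<^sup>2 * t" using assms by auto
  then have y: "e\<^sup>2 * t \<le> 1 + (e\<^sup>2 * t)\<^sup>2" unfolding power2_diff power_one by linarith
  have "x * e ^ 4 * t = (x * e\<^sup>2) * (e\<^sup>2 * t)" by algebra
  also have "\<dots> \<le> (x * e\<^sup>2) * (1 + (e\<^sup>2 * t)\<^sup>2)"
    using assms by (intro mult_left_mono y) auto
  also have "\<dots> = e * (x * e) + e * e * (t\<^sup>2 * e ^ 4 * x)" by algebra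
  also have "\<dots> \<le> e * 4 + e * 1 * (t\<^sup>2 * e ^ 4 * x)"
    using e xe assms by (intro add_mono mult_left_mono mult_right_mono) auto
  finally show ?thesis unfolding e4 e_def[symmetric] by (simp add: algebra_simps)
qed

text \<open>Since \<open>(\<partial>\<^sub>s + \<i> \<partial>\<^sub>\<theta>) \<Psi> = 2 e^(e^(2 s)) cnj H\<close>, multiplication by \<open>\<omega> = e^(-e^(2 s))\<close>
  and the bump function and integration by parts turn the average of \<open>cnj H\<close> into an
  integral of \<open>\<Psi>\<close> against derivatives of \<open>\<omega>\<close> times the bump function, of order \<open>e^(2 s) \<omega>\<close>.
  As \<open>\<Psi>\<close> is square integrable for the weight \<open>\<omega>\<close>, half of this Gaussian factor is left over
  as decay.\<close>

lemma norm_bump_average_le: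
  assumes \<Psi>: "C1_on strip \<Psi> \<Psi>s \<Psi>\<theta>"
    and H: "continuous_on {w. 0 < Im w \<and> Im w < pi} H"
    and eq: "\<And>s \<theta>. (s, \<theta>) \<in> strip \<Longrightarrow>
      \<Psi>s (s, \<theta>) + \<i> * \<Psi>\<theta> (s, \<theta>) = of_real (2 * exp (exp (2 * s))) * cnj (H (Complex s \<theta>))"
    and E: "integral (cbox (- \<delta>, - \<delta>) (\<delta>, \<delta>))
      (\<lambda>q. log_polar_density \<Psi> (Re w + fst q, Im w + snd q)) \<le> E"
    and \<delta>: "0 < \<delta>" "\<delta> \<le> 1 / 10" and w: "0 \<le> Re w" "\<delta> < Im w" "Im w < pi - \<delta>"
  shows "norm (bump_average \<delta> H w) \<le> (80 + 5 * E) * exp (- (1 / 8) * exp (2 * Re w))"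
proof -
  let ?Q = "cbox (- \<delta>, - \<delta>) (\<delta>, \<delta>)"
  have mem: "(Re w + u, Im w + v) \<in> strip" if "(u, v) \<in> ?Q" for u v
    using that w by (auto simp: cbox_Pair_eq strip_def)
  define \<omega> where "\<omega> u = exp (- exp (2 * (Re w + u)))" for u
  define \<Phi> where "\<Phi> q = \<Psi> (Re w + fst q, Im w + snd q)" for q
  define \<Phi>u where "\<Phi>u q = \<Psi>s (Re w + fst q, Im w + snd q)" for q
  define \<Phi>v where "\<Phi>v q = \<Psi>\<theta> (Re w + fst q, Im w + snd q)" for q
  define h where "h q = H (w + Complex (fst q) (snd q))" for q
  \<comment> \<open>\<open>a\<close> and \<open>b\<close> are the partial derivatives of \<open>\<omega> * bump\<close>.\<close>
  define a where "a q = (- 2 * exp (2 * (Re w + fst q)) * \<omega> (fst q) * (\<delta>\<^sup>2 - (fst q)\<^sup>2)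
      - 2 * fst q * \<omega> (fst q)) * (\<delta>\<^sup>2 - (snd q)\<^sup>2)" for q
  define b where "b q = - 2 * snd q * \<omega> (fst q) * (\<delta>\<^sup>2 - (fst q)\<^sup>2)" for q
  define Q where "Q q = (\<omega> (fst q) * bump \<delta> q) *\<^sub>R \<Phi> q" for q
  define Qu where "Qu q = a q *\<^sub>R \<Phi> q + (\<omega> (fst q) * bump \<delta> q) *\<^sub>R \<Phi>u q" for q
  define Qv where "Qv q = b q *\<^sub>R \<Phi> q + (\<omega> (fst q) * bump \<delta> q) *\<^sub>R \<Phi>v q" for q
  have c\<Phi>: "continuous_on ?Q \<Phi>" "continuous_on ?Q \<Phi>u" "continuous_on ?Q \<Phi>v"
    unfolding \<Phi>_def \<Phi>u_def \<Phi>v_def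
    by (rule continuous_on_compose2[OF C1_on_imp_continuous_on[OF \<Psi>]]
        continuous_on_compose2[OF C1_onD(2)[OF \<Psi>]] continuous_on_compose2[OF C1_onD(3)[OF \<Psi>]];
        use mem in \<open>auto intro!: continuous_intros\<close>)+
  have cd: "continuous_on ?Q (\<lambda>q. log_polar_density \<Psi> (Re w + fst q, Im w + snd q))"
    unfolding log_polar_density_def fst_conv by (intro continuous_intros c\<Phi>(1)[unfolded \<Phi>_def])
  have ch: "continuous_on ?Q h"
    unfolding h_def
    by (rule continuous_on_compose2[OF H]) (use mem in \<open>auto intro!: continuous_intros simp: strip_def\<close>)
  have c\<omega>: "continuous_on ?Q (\<lambda>q. \<omega> (fst q))" "continuous_on ?Q (\<lambda>q. bump \<delta> q)"
    "continuous_on ?Q a" "continuous_on ?Q b"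
    unfolding \<omega>_def a_def b_def bump_def by (intro continuous_intros)+
  have cQ: "continuous_on ?Q Qu" "continuous_on ?Q Qv"
    unfolding Qu_def Qv_def by (intro continuous_intros c\<Phi> c\<omega>)+
  have \<omega>': "(\<omega> has_real_derivative (- 2 * exp (2 * (Re w + u)) * \<omega> u)) (at u)" for u
    unfolding \<omega>_def by (auto intro!: derivative_eq_intros)
  have du: "((\<lambda>t. Q (t, v)) has_vector_derivative Qu (u, v)) (at u)"
    if "(u, v) \<in> ?Q" for u v
  proof -
    have "((\<lambda>t. \<Phi> (t, v)) has_vector_derivative \<Phi>u (u, v)) (at u)"
      using C1_on_compose_path[OF \<Psi> _ DERIV_add[OF DERIV_const DERIV_ident] DERIV_const, of "Re w" u "Im w + v"]
        mem[OF that] by (simp add: \<Phi>_def \<Phi>u_def)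
    moreover have "((\<lambda>t. \<omega> t * bump \<delta> (t, v)) has_real_derivative a (u, v)) (at u)"
      unfolding bump_def a_def by (auto intro!: derivative_eq_intros \<omega>' simp: algebra_simps)
    ultimately have "((\<lambda>t. (\<omega> t * bump \<delta> (t, v)) *\<^sub>R \<Phi> (t, v)) has_vector_derivative
        (\<omega> u * bump \<delta> (u, v)) *\<^sub>R \<Phi>u (u, v) + a (u, v) *\<^sub>R \<Phi> (u, v)) (at u)"
      by (rule has_vector_derivative_scaleR[rotated])
    then show ?thesis by (simp add: Q_def Qu_def add.commute)
  qed
  have dv: "((\<lambda>t. Q (u, t)) has_vector_derivative Qv (u, v)) (at v)"
    if "(u, v) \<in> ?Q" for u v
  proof -
    have "((\<lambda>t. \<Phi> (u, t)) has_vector_derivative \<Phi>v (u, v)) (at v)"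
      using C1_on_compose_path[OF \<Psi> _ DERIV_const DERIV_add[OF DERIV_const DERIV_ident], of "Re w + u" "Im w" v]
        mem[OF that] by (simp add: \<Phi>_def \<Phi>v_def)
    moreover have "((\<lambda>t. \<omega> u * bump \<delta> (u, t)) has_real_derivative b (u, v)) (at v)"
      unfolding bump_def b_def by (auto intro!: derivative_eq_intros simp: algebra_simps)
    ultimately have "((\<lambda>t. (\<omega> u * bump \<delta> (u, t)) *\<^sub>R \<Phi> (u, t)) has_vector_derivative
        (\<omega> u * bump \<delta> (u, v)) *\<^sub>R \<Phi>v (u, v) + b (u, v) *\<^sub>R \<Phi> (u, v)) (at v)"
      by (rule has_vector_derivative_scaleR[rotated])
    then show ?thesis by (simp add: Q_def Qv_def add.commute)
  qed
  have "integral ?Q Qu = integral {- \<delta>..\<delta>} (\<lambda>v. Q (\<delta>, v) - Q (- \<delta>, v))"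
    using \<delta> cQ du by (intro integral_cbox_partial1) (auto simp: cbox_Pair_eq)
  then have Iu: "integral ?Q Qu = 0" by (simp add: Q_def bump_def)
  have "integral ?Q Qv = integral {- \<delta>..\<delta>} (\<lambda>u. Q (u, \<delta>) - Q (u, - \<delta>))"
    using \<delta> cQ dv by (intro integral_cbox_partial2) (auto simp: cbox_Pair_eq)
  then have Iv: "integral ?Q Qv = 0" by (simp add: Q_def bump_def)
  have Quv: "Qu q + \<i> * Qv q = 2 * cnj (bump \<delta> q *\<^sub>R h q) + (of_real (a q) + \<i> * of_real (b q)) * \<Phi> q"
    if "q \<in> ?Q" for q
  proof -
    have wC: "w + Complex (fst q) (snd q) = Complex (Re w + fst q) (Im w + snd q)"
      by (simp add: complex_eq_iff)
    have "\<Phi>u q + \<i> * \<Phi>v q = of_real (2 * exp (exp (2 * (Re w + fst q)))) * cnj (h q)"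
      unfolding \<Phi>u_def \<Phi>v_def h_def wC using that by (intro eq mem) simp
    then have "of_real (\<omega> (fst q) * bump \<delta> q) * (\<Phi>u q + \<i> * \<Phi>v q) =
        of_real (\<omega> (fst q) * exp (exp (2 * (Re w + fst q)))) * (2 * cnj (bump \<delta> q *\<^sub>R h q))"
      by (simp add: scaleR_conv_of_real)
    also have "\<omega> (fst q) * exp (exp (2 * (Re w + fst q))) = 1"
      by (simp add: \<omega>_def flip: exp_add)
    finally show ?thesis
      by (simp add: Qu_def Qv_def scaleR_conv_of_real algebra_simps)
  qed
  let ?J = "\<lambda>q. (of_real (a q) + \<i> * of_real (b q)) * \<Phi> q"
  have cJ: "continuous_on ?Q ?J" by (intro continuous_intros c\<Phi> c\<omega>)
  have cB: "continuous_on ?Q (\<lambda>q. 2 * cnj (bump \<delta> q *\<^sub>R h q))" by (intro continuous_intros c\<omega> ch)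
  \<comment> \<open>Both integrals vanish because \<open>Q\<close> is zero on the boundary of the square.\<close>
  have "0 = integral ?Q (\<lambda>q. Qu q + \<i> * Qv q)"
    using Iu Iv cQ by (simp add: integral_add integrable_continuous continuous_on_mult_left)
  also have "\<dots> = integral ?Q (\<lambda>q. 2 * cnj (bump \<delta> q *\<^sub>R h q) + ?J q)"
    by (rule integral_cong) (rule Quv)
  also have "\<dots> = integral ?Q (\<lambda>q. 2 * cnj (bump \<delta> q *\<^sub>R h q)) + integral ?Q ?J"
    by (intro integral_add integrable_continuous cJ cB)
  also have "integral ?Q (\<lambda>q. 2 * cnj (bump \<delta> q *\<^sub>R h q)) = 2 * cnj (bump_average \<delta> H w)"
    unfolding bump_average_def integral_cnj h_def by (rule integral_mult_right)
  finally have "2 * cnj (bump_average \<delta> H w) = - integral ?Q ?J"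
    by (simp add: eq_neg_iff_add_eq_0)
  from arg_cong[OF this, of norm] have "2 * norm (bump_average \<delta> H w) = norm (integral ?Q ?J)"
    by (simp only: norm_minus_cancel norm_mult norm_numeral complex_mod_cnj)
  also have "\<dots> \<le> integral ?Q (\<lambda>q. exp (- (1 / 8) * exp (2 * Re w)) *
      (40 + 10 * log_polar_density \<Psi> (Re w + fst q, Im w + snd q)))"
  proof (rule integral_norm_bound_integral)
    show "?J integrable_on ?Q" by (intro integrable_continuous cJ)
    show "(\<lambda>q. exp (- (1 / 8) * exp (2 * Re w)) *
      (40 + 10 * log_polar_density \<Psi> (Re w + fst q, Im w + snd q))) integrable_on ?Q"
      by (intro integrable_continuous continuous_intros cd)
  next
    fix q assume q: "q \<in> ?Q"
    obtain u v where uv: "q = (u, v)" by (cases q)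
    have u: "\<bar>u\<bar> \<le> \<delta>" and v: "\<bar>v\<bar> \<le> \<delta>" using q by (auto simp: uv cbox_Pair_eq)
    have sq: "0 \<le> \<delta>\<^sup>2 - u\<^sup>2" "\<delta>\<^sup>2 - u\<^sup>2 \<le> 1" "0 \<le> \<delta>\<^sup>2 - v\<^sup>2" "\<delta>\<^sup>2 - v\<^sup>2 \<le> 1"
    proof -
      have "u\<^sup>2 \<le> \<delta>\<^sup>2" "v\<^sup>2 \<le> \<delta>\<^sup>2" "\<delta>\<^sup>2 \<le> 1"
        using power_mono[OF u, of 2] power_mono[OF v, of 2] power_mono[of \<delta> 1 2] \<delta> by simp_all
      moreover have "0 \<le> u\<^sup>2" "0 \<le> v\<^sup>2" by simp_all
      ultimately show "0 \<le> \<delta>\<^sup>2 - u\<^sup>2" "\<delta>\<^sup>2 - u\<^sup>2 \<le> 1" "0 \<le> \<delta>\<^sup>2 - v\<^sup>2" "\<delta>\<^sup>2 - v\<^sup>2 \<le> 1"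
        by linarith+
    qed
    define x where "x = exp (2 * (Re w + u))"
    have x0: "x > 0" by (simp add: x_def)
    \<comment> \<open>\<open>\<delta> \<le> 1 / 10\<close> keeps \<open>x\<close> within a factor \<open>2\<close> of its value at the centre of the square,
      so that \<open>x / 4\<close> is at least \<open>1 / 8\<close> of the latter.\<close>
    have "1 / 2 \<le> exp (2 * u)" using exp_ge_add_one_self[of "2 * u"] u \<delta> by linarith
    then have "1 / 2 * exp (2 * Re w) \<le> exp (2 * u) * exp (2 * Re w)"
      by (rule mult_right_mono) simp
    also have "\<dots> = x" by (simp add: x_def algebra_simps flip: exp_add)
    finally have x: "1 / 2 * exp (2 * Re w) \<le> x" .
    have "1 \<le> exp (2 * Re w)" using w by simp
    then have x1: "1 \<le> 2 * x" using x by linarith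
    have om: "\<omega> u = exp (- x)" by (simp add: \<omega>_def x_def)
    have "\<bar>a q\<bar> \<le> (2 * x * exp (- x) * 1 + 2 * 1 * exp (- x)) * 1"
      unfolding a_def abs_mult uv fst_conv snd_conv om x_def[symmetric]
    proof (intro mult_mono)
      have "\<bar>- 2 * x * exp (- x) * (\<delta>\<^sup>2 - u\<^sup>2) - 2 * u * exp (- x)\<bar>
          \<le> \<bar>- 2 * x * exp (- x) * (\<delta>\<^sup>2 - u\<^sup>2)\<bar> + \<bar>2 * u * exp (- x)\<bar>" by linarith
      also have "\<dots> \<le> 2 * x * exp (- x) * 1 + 2 * 1 * exp (- x)"
        unfolding abs_mult using sq u x0 \<delta> by (intro add_mono mult_mono) auto
      finally show "\<bar>- 2 * x * exp (- x) * (\<delta>\<^sup>2 - u\<^sup>2) - 2 * u * exp (- x)\<bar>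
          \<le> 2 * x * exp (- x) * 1 + 2 * 1 * exp (- x)" .
    qed (use sq x0 in auto)
    moreover have "\<bar>b q\<bar> \<le> 2 * 1 * exp (- x) * 1"
      unfolding b_def abs_mult uv fst_conv snd_conv om using sq v \<delta> by (intro mult_mono) auto
    moreover have "1 * exp (- x) \<le> (2 * x) * exp (- x)" using x1 by (intro mult_right_mono) auto
    ultimately have ab: "\<bar>a q\<bar> + \<bar>b q\<bar> \<le> 10 * (x * exp (- x))"
      using mult_pos_pos[OF x0, of "exp (- x)"] by (simp only: mult.assoc mult_1_left mult_1_right)
    have "norm (?J q) = norm (of_real (a q) + \<i> * of_real (b q)) * norm (\<Phi> q)"
      by (rule norm_mult)
    also have "\<dots> \<le> (10 * (x * exp (- x))) * norm (\<Phi> q)"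
      using ab by (intro mult_right_mono order_trans[OF norm_triangle_ineq]) (auto simp: norm_mult)
    also have "\<dots> = 10 * (x * exp (- x) * norm (\<Phi> q))" by simp
    also have "\<dots> \<le> 10 * (exp (- x / 4) * (4 + (norm (\<Phi> q))\<^sup>2 * exp (- x) * x))"
      by (intro mult_left_mono weighted_norm_le x0) auto
    also have "(norm (\<Phi> q))\<^sup>2 * exp (- x) * x = log_polar_density \<Psi> (Re w + fst q, Im w + snd q)"
      by (simp add: log_polar_density_def \<Phi>_def x_def uv)
    also have "10 * (exp (- x / 4) * (4 + \<dots>)) \<le> 10 * (exp (- (1 / 8) * exp (2 * Re w)) * (4 + \<dots>))"
      using x by (intro mult_left_mono mult_right_mono) (auto simp: log_polar_density_def)
    finally show "norm (?J q) \<le> exp (- (1 / 8) * exp (2 * Re w)) *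
      (40 + 10 * log_polar_density \<Psi> (Re w + fst q, Im w + snd q))"
      by (simp add: algebra_simps)
  qed
  also have "\<dots> = exp (- (1 / 8) * exp (2 * Re w)) *
      (40 * (2 * \<delta> * (2 * \<delta>)) + 10 * integral ?Q (\<lambda>q. log_polar_density \<Psi> (Re w + fst q, Im w + snd q)))"
  proof -
    have "(\<lambda>q. log_polar_density \<Psi> (Re w + fst q, Im w + snd q)) integrable_on ?Q"
      by (intro integrable_continuous cd)
    then have "integral ?Q (\<lambda>q. 40 + 10 * log_polar_density \<Psi> (Re w + fst q, Im w + snd q)) =
        40 * measure lborel ?Q + 10 * integral ?Q (\<lambda>q. log_polar_density \<Psi> (Re w + fst q, Im w + snd q))"
      by (subst integral_add) auto
    also have "measure lborel ?Q = 2 * \<delta> * (2 * \<delta>)"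
      using \<delta> by (simp add: content_Pair)
    finally show ?thesis by simp
  qed
  also have "\<dots> \<le> exp (- (1 / 8) * exp (2 * Re w)) * (40 * (2 * 1 * (2 * 1)) + 10 * E)"
    using \<delta> E by (intro mult_left_mono add_mono mult_mono) auto
  finally show ?thesis by (simp add: algebra_simps)
qed

text \<open>All averages of \<open>H\<close> over small squares decay like \<open>exp (- exp (2 s) / 8)\<close> to the
  right, which is too fast for a non-zero holomorphic function: by the Phragmen--Lindelof
  argument they vanish on the right half of the centre line. Letting the squares shrink, so
  does \<open>H\<close>, and the identity theorem extends this to the whole strip.\<close>

lemma strip_vanishing:
  assumes \<Psi>: "C1_on strip \<Psi> \<Psi>s \<Psi>\<theta>"
    and H: "H holomorphic_on {w. 0 < Im w \<and> Im w < pi}"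
    and eq: "\<And>s \<theta>. (s, \<theta>) \<in> strip \<Longrightarrow>
      \<Psi>s (s, \<theta>) + \<i> * \<Psi>\<theta> (s, \<theta>) = of_real (2 * exp (exp (2 * s))) * cnj (H (Complex s \<theta>))"
    and E: "\<And>\<delta> s \<theta>. 0 < \<delta> \<Longrightarrow> \<delta> < \<theta> \<Longrightarrow> \<theta> < pi - \<delta> \<Longrightarrow>
      integral (cbox (- \<delta>, - \<delta>) (\<delta>, \<delta>)) (\<lambda>q. log_polar_density \<Psi> (s + fst q, \<theta> + snd q)) \<le> E"
    and E0: "0 \<le> E" and w: "0 < Im w" "Im w < pi"
  shows "H w = 0"
proof -
  \<comment> \<open>Squares of half-width less than \<open>pi / 6\<close> with centre within \<open>pi / 3\<close> of the centre line stay in the strip.\<close>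
  have pi3: "1 / 10 < pi / 6" using pi_gt3 by linarith
  have line: "H (Complex s (pi / 2)) = 0" if s: "0 < s" for s
  proof -
    let ?\<phi> = "\<lambda>q. H (Complex s (pi / 2) + Complex (fst q) (snd q))"
    have "?\<phi> (0, 0) = 0"
    proof (rule zero_if_averages_zero[where \<phi>="?\<phi>" and W=bump and r="1/10"])
      show "continuous_on (cbox (0 - 1/10, 0 - 1/10) (0 + 1/10, 0 + 1/10)) ?\<phi>"
        by (rule continuous_on_compose2[OF holomorphic_on_imp_continuous_on[OF H]])
          (use pi3 in \<open>auto intro!: continuous_intros simp: cbox_Pair_eq\<close>)
    next
      fix \<delta> :: real assume \<delta>: "0 < \<delta>" "\<delta> < 1/10"
      show "continuous_on UNIV (bump \<delta>)"
        using continuous_on_bump[OF continuous_on_id] by simp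
      show "0 \<le> bump \<delta> q" if "q \<in> cbox (0 - \<delta>, 0 - \<delta>) (0 + \<delta>, 0 + \<delta>)" for q
      proof -
        have "\<bar>fst q\<bar> \<le> \<delta>" "\<bar>snd q\<bar> \<le> \<delta>"
          using that by (cases q, auto simp: cbox_Pair_eq)+
        from this[THEN power_mono[OF _ abs_ge_zero], of 2] show ?thesis by (simp add: bump_def)
      qed
      show "0 < bump \<delta> (0, 0)" using \<delta> by (simp add: bump_def)
      have "bump_average \<delta> H (Complex s (pi / 2)) = 0"
      proof (rule Phragmen_Lindelof_half_strip)
        show "bump_average \<delta> H holomorphic_on {w. \<delta> < Im w \<and> Im w < pi - \<delta>}"
          by (rule holomorphic_bump_average[OF H \<delta>(1)])
        show "open {w. \<delta> < Im w \<and> Im w < pi - \<delta>}"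
          by (intro open_Collect_conj open_Collect_less continuous_intros)
        fix w :: complex assume w: "0 \<le> Re w" "\<bar>Im w - pi / 2\<bar> \<le> pi / 3"
        then have w': "\<delta> < Im w" "Im w < pi - \<delta>"
          using \<delta> pi3 unfolding abs_le_iff by linarith+
        then show "w \<in> {w. \<delta> < Im w \<and> Im w < pi - \<delta>}" by simp
        show "norm (bump_average \<delta> H w) \<le> (80 + 5 * E) * exp (- (1 / 8) * exp (2 * Re w))"
          using \<delta> w w' by (intro norm_bump_average_le[OF \<Psi> holomorphic_on_imp_continuous_on[OF H] eq E]) auto
      qed (use s E0 in auto)
      then show "integral (cbox (0 - \<delta>, 0 - \<delta>) (0 + \<delta>, 0 + \<delta>)) (\<lambda>q. bump \<delta> q *\<^sub>R ?\<phi> q) = 0"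
        by (simp add: bump_average_def)
    qed simp
    then show ?thesis by (simp flip: zero_complex.code)
  qed
  show ?thesis
  proof (rule analytic_continuation[OF H])
    let ?T = "{w. 0 < Im w \<and> Im w < pi}" and ?U = "(\<lambda>s. Complex s (pi / 2)) ` {0<..}"
    show "open ?T" by (intro open_Collect_conj open_Collect_less continuous_intros)
    have "?T = {w. 0 < Im w} \<inter> {w. Im w < pi}" by auto
    then show "connected ?T"
      by (simp add: convex_connected convex_Int convex_halfspace_Im_gt convex_halfspace_Im_lt)
    show "?U \<subseteq> ?T" "Complex 1 (pi / 2) \<in> ?T" by auto
    show "Complex 1 (pi / 2) islimpt ?U"
      unfolding islimpt_approachable
    proof (intro allI impI)
      fix e :: real assume "e > 0"
      then have "Complex (1 + e / 2) (pi / 2) \<in> ?U" "Complex (1 + e / 2) (pi / 2) \<noteq> Complex 1 (pi / 2)"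
        "dist (Complex (1 + e / 2) (pi / 2)) (Complex 1 (pi / 2)) < e"
        by (auto simp: dist_norm cmod_def)
      then show "\<exists>x'\<in>?U. x' \<noteq> Complex 1 (pi / 2) \<and> dist x' (Complex 1 (pi / 2)) < e" by blast
    qed
  qed (use line w in auto)
qed

section \<open>Square integrable solutions on the half plane are holomorphic\<close>

definition half_plane :: "(real \<times> real) set"
  where "half_plane = UNIV \<times> {0<..}"

lemma C1_on_log_polar:
  assumes F: "C1_on half_plane F Fx Fy"
  shows "C1_on strip (\<lambda>p. F (exp (fst p) * cos (snd p), exp (fst p) * sin (snd p)))
    (\<lambda>p. (exp (fst p) * cos (snd p)) *\<^sub>R Fx (exp (fst p) * cos (snd p), exp (fst p) * sin (snd p)) +
         (exp (fst p) * sin (snd p)) *\<^sub>R Fy (exp (fst p) * cos (snd p), exp (fst p) * sin (snd p)))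
    (\<lambda>p. (- (exp (fst p) * sin (snd p))) *\<^sub>R Fx (exp (fst p) * cos (snd p), exp (fst p) * sin (snd p)) +
         (exp (fst p) * cos (snd p)) *\<^sub>R Fy (exp (fst p) * cos (snd p), exp (fst p) * sin (snd p)))"
proof -
  let ?g = "\<lambda>p::real \<times> real. (exp (fst p) * cos (snd p), exp (fst p) * sin (snd p))"
  have mem: "?g p \<in> half_plane" if "p \<in> strip" for p
    using that by (auto simp: half_plane_def strip_def sin_gt_zero)
  have cg: "continuous_on strip ?g" by (intro continuous_intros)
  have der: "(?g has_derivative (\<lambda>h. (fst h * (exp (fst p) * cos (snd p)) - snd h * (exp (fst p) * sin (snd p)),
      fst h * (exp (fst p) * sin (snd p)) + snd h * (exp (fst p) * cos (snd p))))) (at p)" for p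
    by (rule has_derivative_Pair) (auto intro!: derivative_eq_intros simp: algebra_simps)
  have "((\<lambda>p. F (?g p)) has_derivative (\<lambda>h. fst h *\<^sub>R ((exp (fst p) * cos (snd p)) *\<^sub>R Fx (?g p) +
        (exp (fst p) * sin (snd p)) *\<^sub>R Fy (?g p)) +
      snd h *\<^sub>R ((- (exp (fst p) * sin (snd p))) *\<^sub>R Fx (?g p) + (exp (fst p) * cos (snd p)) *\<^sub>R Fy (?g p)))) (at p)"
    if "p \<in> strip" for p
    using has_derivative_compose[OF der C1_onD(1)[OF F mem[OF that]]]
    by (simp add: algebra_simps)
  moreover have "continuous_on strip (\<lambda>p. Fx (?g p))" "continuous_on strip (\<lambda>p. Fy (?g p))"
    by (rule continuous_on_compose2[OF C1_onD(2)[OF F] cg] continuous_on_compose2[OF C1_onD(3)[OF F] cg];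
        use mem in blast)+
  ultimately show ?thesis
    unfolding C1_on_def by (auto intro!: continuous_intros)
qed

text \<open>The weight \<open>e^(-\<bar>z\<bar>\<^sup>2)\<close> is an integrating factor: \<open>\<partial> G = cnj z * G\<close> says that
  \<open>e^(-\<bar>z\<bar>\<^sup>2) * G\<close> is antiholomorphic, hence its conjugate holomorphic.\<close>

lemma C1_on_gaussian_cnj:
  assumes G: "C1_on D G Gx Gy"
  shows "C1_on D (\<lambda>p. exp (- ((fst p)\<^sup>2 + (snd p)\<^sup>2)) *\<^sub>R cnj (G p))
    (\<lambda>p. exp (- ((fst p)\<^sup>2 + (snd p)\<^sup>2)) *\<^sub>R (cnj (Gx p) - (2 * fst p) *\<^sub>R cnj (G p)))
    (\<lambda>p. exp (- ((fst p)\<^sup>2 + (snd p)\<^sup>2)) *\<^sub>R (cnj (Gy p) - (2 * snd p) *\<^sub>R cnj (G p)))"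
proof -
  let ?e = "\<lambda>p::real \<times> real. exp (- ((fst p)\<^sup>2 + (snd p)\<^sup>2))"
  have e: "(?e has_derivative (\<lambda>h. - ?e p * (2 * fst p * fst h + 2 * snd p * snd h))) (at p)" for p
    by (auto intro!: derivative_eq_intros simp: algebra_simps)
  have C: "C1_on D (\<lambda>p. cnj (G p)) (\<lambda>p. cnj (Gx p)) (\<lambda>p. cnj (Gy p))"
    by (rule C1_on_bounded_linear[OF G bounded_linear_cnj])
  have "((\<lambda>p. ?e p *\<^sub>R cnj (G p)) has_derivative
      (\<lambda>h. fst h *\<^sub>R (?e p *\<^sub>R (cnj (Gx p) - (2 * fst p) *\<^sub>R cnj (G p))) +
        snd h *\<^sub>R (?e p *\<^sub>R (cnj (Gy p) - (2 * snd p) *\<^sub>R cnj (G p))))) (at p)"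
    if "p \<in> D" for p
  proof -
    have "(\<lambda>h. ?e p *\<^sub>R (fst h *\<^sub>R cnj (Gx p) + snd h *\<^sub>R cnj (Gy p)) +
          (- ?e p * (2 * fst p * fst h + 2 * snd p * snd h)) *\<^sub>R cnj (G p)) =
        (\<lambda>h. fst h *\<^sub>R (?e p *\<^sub>R (cnj (Gx p) - (2 * fst p) *\<^sub>R cnj (G p))) +
        snd h *\<^sub>R (?e p *\<^sub>R (cnj (Gy p) - (2 * snd p) *\<^sub>R cnj (G p))))"
      by (simp add: fun_eq_iff scaleR_conv_of_real algebra_simps)
    with has_derivative_scaleR[OF e C1_onD(1)[OF C that]] show ?thesis by simp
  qed
  then show ?thesis
    unfolding C1_on_def
    by (intro conjI continuous_intros C1_on_imp_continuous_on[OF G] C1_onD(2)[OF G] C1_onD(3)[OF G]) blast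
qed

text \<open>With \<open>G = F\<^sub>x + \<i> F\<^sub>y\<close>, twice the antiholomorphic derivative of \<open>F\<close>, the equation
  reads \<open>\<partial> G = cnj z * G\<close>, so \<open>\<kappa> = e^(-\<bar>z\<bar>\<^sup>2) * cnj G\<close> is holomorphic. In logarithmic
  coordinates \<open>z = e^w\<close> the function \<open>F\<close> satisfies
  \<open>(\<partial>\<^sub>s + \<i> \<partial>\<^sub>\<theta>) F = cnj z * G = 2 e^(e^(2 s)) cnj H\<close> with \<open>H w = e^w \<kappa> (e^w) / 2\<close>, and
  square integrability forces \<open>H = 0\<close>.\<close>

lemma half_plane_dbar_zero:
  fixes F :: "real \<times> real \<Rightarrow> complex"
  assumes F: "C1_on half_plane F Fx Fy"
    and Fx: "C1_on half_plane Fx Fxx Fxy" and Fy: "C1_on half_plane Fy Fyx Fyy"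
    and eq: "\<And>x y. y > 0 \<Longrightarrow> Fxx (x, y) + Fyy (x, y) =
      2 * (x *\<^sub>R Fx (x, y) + y *\<^sub>R Fy (x, y)) + 2 * \<i> * (x *\<^sub>R Fy (x, y) - y *\<^sub>R Fx (x, y))"
    and E: "\<And>\<delta> s \<theta>. 0 < \<delta> \<Longrightarrow> \<delta> < \<theta> \<Longrightarrow> \<theta> < pi - \<delta> \<Longrightarrow>
      integral (cbox (- \<delta>, - \<delta>) (\<delta>, \<delta>)) (\<lambda>q. log_polar_density
        (\<lambda>p. F (exp (fst p) * cos (snd p), exp (fst p) * sin (snd p))) (s + fst q, \<theta> + snd q)) \<le> E"
    and E0: "0 \<le> E" and y: "y > 0"
  shows "Fx (x, y) + \<i> * Fy (x, y) = 0"
proof -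
  have op: "open half_plane" unfolding half_plane_def by (intro open_Times) auto
  define G where "G p = Fx p + \<i> * Fy p" for p
  have G: "C1_on half_plane G (\<lambda>p. Fxx p + \<i> * Fyx p) (\<lambda>p. Fxy p + \<i> * Fyy p)"
  proof -
    have I: "C1_on half_plane (\<lambda>p. \<i> * Fy p) (\<lambda>p. \<i> * Fyx p) (\<lambda>p. \<i> * Fyy p)"
      by (rule C1_on_bounded_linear[OF Fy bounded_linear_mult_right])
    have "(G has_derivative (\<lambda>h. fst h *\<^sub>R (Fxx p + \<i> * Fyx p) + snd h *\<^sub>R (Fxy p + \<i> * Fyy p))) (at p)"
      if "p \<in> half_plane" for p
      using has_derivative_add[OF C1_onD(1)[OF Fx that] C1_onD(1)[OF I that]]
      by (simp add: G_def[abs_def] algebra_simps)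
    then show ?thesis
      using C1_onD(2,3)[OF Fx] C1_onD(2,3)[OF I] unfolding C1_on_def
      by (auto intro!: continuous_on_add)
  qed
  define k where "k p = exp (- ((fst p)\<^sup>2 + (snd p)\<^sup>2)) *\<^sub>R cnj (G p)" for p
  have CR: "((\<lambda>z. k (Re z, Im z)) has_field_derivative
      exp (- ((Re z)\<^sup>2 + (Im z)\<^sup>2)) *\<^sub>R (cnj (Fxx (Re z, Im z) + \<i> * Fyx (Re z, Im z))
        - (2 * Re z) *\<^sub>R cnj (G (Re z, Im z)))) (at z)"
    if z: "0 < Im z" for z
  proof -
    have mem: "(Re z, Im z) \<in> half_plane" using z by (simp add: half_plane_def)
    have mix: "Fxy (Re z, Im z) = Fyx (Re z, Im z)"
      by (rule mixed_partials_eq[OF op F Fx Fy mem])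
    have 1: "(Fxx (Re z, Im z) + \<i> * Fyx (Re z, Im z)) - \<i> * (Fxy (Re z, Im z) + \<i> * Fyy (Re z, Im z)) =
        2 * cnj z * G (Re z, Im z)"
      using eq[OF z, of "Re z"] unfolding mix G_def
      by (simp add: complex_eq_iff algebra_simps)
    have 2: "cnj (Fxx (Re z, Im z) + \<i> * Fyx (Re z, Im z)) + \<i> * cnj (Fxy (Re z, Im z) + \<i> * Fyy (Re z, Im z)) =
        2 * z * cnj (G (Re z, Im z))"
      using arg_cong[OF 1, of cnj] by (simp add: algebra_simps)
    have 3: "exp (- ((Re z)\<^sup>2 + (Im z)\<^sup>2)) *\<^sub>R
          (cnj (Fxx (Re z, Im z) + \<i> * Fyx (Re z, Im z)) - (2 * Re z) *\<^sub>R cnj (G (Re z, Im z))) +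
        \<i> * (exp (- ((Re z)\<^sup>2 + (Im z)\<^sup>2)) *\<^sub>R
          (cnj (Fxy (Re z, Im z) + \<i> * Fyy (Re z, Im z)) - (2 * Im z) *\<^sub>R cnj (G (Re z, Im z)))) =
      exp (- ((Re z)\<^sup>2 + (Im z)\<^sup>2)) *\<^sub>R (
        (cnj (Fxx (Re z, Im z) + \<i> * Fyx (Re z, Im z)) + \<i> * cnj (Fxy (Re z, Im z) + \<i> * Fyy (Re z, Im z)))
        - 2 * (of_real (Re z) + \<i> * of_real (Im z)) * cnj (G (Re z, Im z)))"
      by (simp add: scaleR_conv_of_real algebra_simps)
    have "\<dots> = 0" unfolding 2 complex_eq[symmetric] by simp
    with 3 C1_on_Cauchy_Riemann[OF C1_on_gaussian_cnj[OF G] _ mem]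
    show ?thesis unfolding k_def fst_conv snd_conv by simp
  qed
  define \<kappa> where "\<kappa> z = k (Re z, Im z)" for z
  have \<kappa>: "\<kappa> holomorphic_on {z. 0 < Im z}"
    unfolding \<kappa>_def holomorphic_on_def field_differentiable_def
    using CR by (blast intro: has_field_derivative_at_within)
  define H where "H w = exp w * \<kappa> (exp w) / 2" for w
  have H: "H holomorphic_on {w. 0 < Im w \<and> Im w < pi}"
  proof -
    have "(\<kappa> \<circ> exp) holomorphic_on {w. 0 < Im w \<and> Im w < pi}"
      by (rule holomorphic_on_compose_gen[OF holomorphic_on_exp \<kappa>])
        (auto simp: Im_exp sin_gt_zero)
    then show ?thesis unfolding H_def by (intro holomorphic_intros) (simp_all add: o_def)
  qed
  have "H (Ln (Complex x y)) = 0"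
  proof (rule strip_vanishing[OF C1_on_log_polar[OF F] H _ E E0])
    show "0 < Im (Ln (Complex x y))" "Im (Ln (Complex x y)) < pi"
      using Im_Ln_pos_lt[of "Complex x y"] y by (auto simp: complex_eq_iff)
  next
    fix s \<theta> assume "(s, \<theta>) \<in> strip"
    define X Y where "X = exp s * cos \<theta>" and "Y = exp s * sin \<theta>"
    have XY: "exp (Complex s \<theta>) = Complex X Y"
      by (simp add: X_def Y_def complex_eq_iff Re_exp Im_exp)
    have n: "X\<^sup>2 + Y\<^sup>2 = exp (2 * s)"
      by (simp add: X_def Y_def power_mult_distrib exp_double flip: distrib_left)
    have "of_real (2 * exp (exp (2 * s))) * cnj (H (Complex s \<theta>)) =
        of_real (exp (X\<^sup>2 + Y\<^sup>2)) * of_real (exp (- (X\<^sup>2 + Y\<^sup>2))) * (cnj (Complex X Y) * G (X, Y))"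
      unfolding H_def XY \<kappa>_def k_def by (simp add: n scaleR_conv_of_real)
    also have "of_real (exp (X\<^sup>2 + Y\<^sup>2)) * of_real (exp (- (X\<^sup>2 + Y\<^sup>2))) = (1::complex)"
      by (simp flip: of_real_mult exp_add)
    finally show "(exp (fst (s, \<theta>)) * cos (snd (s, \<theta>))) *\<^sub>R
        Fx (exp (fst (s, \<theta>)) * cos (snd (s, \<theta>)), exp (fst (s, \<theta>)) * sin (snd (s, \<theta>))) +
      (exp (fst (s, \<theta>)) * sin (snd (s, \<theta>))) *\<^sub>R
        Fy (exp (fst (s, \<theta>)) * cos (snd (s, \<theta>)), exp (fst (s, \<theta>)) * sin (snd (s, \<theta>))) +
      \<i> * ((- (exp (fst (s, \<theta>)) * sin (snd (s, \<theta>)))) *\<^sub>R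
        Fx (exp (fst (s, \<theta>)) * cos (snd (s, \<theta>)), exp (fst (s, \<theta>)) * sin (snd (s, \<theta>))) +
      (exp (fst (s, \<theta>)) * cos (snd (s, \<theta>))) *\<^sub>R
        Fy (exp (fst (s, \<theta>)) * cos (snd (s, \<theta>)), exp (fst (s, \<theta>)) * sin (snd (s, \<theta>)))) =
      of_real (2 * exp (exp (2 * s))) * cnj (H (Complex s \<theta>))"
      unfolding fst_conv snd_conv X_def[symmetric] Y_def[symmetric] G_def
      by (simp add: complex_eq_iff algebra_simps)
  qed
  moreover have "Complex x y \<noteq> 0" using y by (simp add: complex_eq_iff)
  ultimately have "\<kappa> (Complex x y) = 0" by (simp add: H_def exp_Ln)
  then have "G (x, y) = 0" by (simp add: \<kappa>_def k_def)
  then show ?thesis by (simp add: G_def)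
qed

section \<open>Complex coordinates on a slice\<close>

text \<open>The \<open>\<complex>\<^sub>I\<close>-component of a quaternion, with \<open>\<complex>\<^sub>I\<close> identified with the complex numbers.
  It commutes with left multiplication by \<open>I\<close>; composed with right multiplications, which
  leave this property intact, it yields complex coordinates on the quaternions without a
  choice of a unit orthogonal to \<open>I\<close>.\<close>

definition cpart :: "quat \<Rightarrow> quat \<Rightarrow> complex"
  where "cpart I q = Complex (qre q) (inner I q)"

lemma bounded_linear_qre: "bounded_linear qre"
proof -
  have "bounded_linear (\<lambda>q::quat. inner q 1)" by (rule bounded_linear_inner_left)
  then show ?thesis by (simp add: inner_quat one_quat)
qed

lemma bounded_linear_cpart: "bounded_linear (cpart I)"
proof -
  have "cpart I = (\<lambda>q. of_real (qre q) + \<i> * of_real (inner I q))"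
    by (simp add: fun_eq_iff cpart_def Complex_eq)
  moreover have "bounded_linear (\<lambda>q. of_real (qre q) + \<i> * of_real (inner I q) :: complex)"
    by (intro bounded_linear_add bounded_linear_const_mult
        bounded_linear_compose[OF bounded_linear_of_real] bounded_linear_qre bounded_linear_inner_right)
  ultimately show ?thesis by simp
qed

lemma imag_units_sum_squares:
  assumes "I \<in> imag_units"
  shows "qre I = 0" "(qi I)\<^sup>2 + (qj I)\<^sup>2 + (qk I)\<^sup>2 = 1"
  using assms by (auto simp: imag_units_iff norm_quat)

lemma cpart_mult_left:
  assumes "I \<in> imag_units"
  shows "cpart I (I * q) = \<i> * cpart I q"
proof -
  have "(qi I * qi I + qj I * qj I + qk I * qk I) * qre q = 1 * qre q"
    using imag_units_sum_squares[OF assms] by (simp only: power2_eq_square)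
  then show ?thesis
    using imag_units_sum_squares(1)[OF assms]
    by (simp add: cpart_def complex_eq_iff times_quat inner_quat algebra_simps)
qed

lemma norm_cpart_le:
  assumes "I \<in> imag_units"
  shows "norm (cpart I q) \<le> 2 * norm q"
proof -
  have "\<bar>qre q\<bar> \<le> norm q"
    using Cauchy_Schwarz_ineq2[of q 1] by (simp add: inner_quat) (simp add: one_quat)
  moreover have "\<bar>inner I q\<bar> \<le> norm q"
    using Cauchy_Schwarz_ineq2[of I q] assms by (simp add: imag_units_iff)
  ultimately show ?thesis
    using cmod_le[of "cpart I q"] by (simp add: cpart_def)
qed

definition quat_units :: "quat set"
  where "quat_units = {1, Quat 0 1 0 0, Quat 0 0 1 0, Quat 0 0 0 1}"

text \<open>The four real components of a quaternion are, up to sign, the real parts of its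
  products with the four units.\<close>

lemma eq_0_if_cparts_0:
  assumes "\<And>c. c \<in> quat_units \<Longrightarrow> Re (cpart I (q * c)) = 0"
  shows "q = 0"
  using assms[of 1] assms[of "Quat 0 1 0 0"] assms[of "Quat 0 0 1 0"] assms[of "Quat 0 0 0 1"]
  by (simp add: quat_units_def cpart_def times_quat one_quat quat_eq_iff)

lemma norm_quat_units: "c \<in> quat_units \<Longrightarrow> norm c = 1"
  by (auto simp: quat_units_def norm_quat one_quat)

lemma norm_slice_pt:
  assumes "I \<in> imag_units"
  shows "(norm (slice_pt I (x, y)))\<^sup>2 = x\<^sup>2 + y\<^sup>2"
proof -
  have "(qi I * qi I + qj I * qj I + qk I * qk I) * (y * y) = 1 * (y * y)"
    using imag_units_sum_squares[OF assms] by (simp only: power2_eq_square)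
  then show ?thesis
    using imag_units_sum_squares(1)[OF assms]
    by (simp add: slice_pt_def norm_quat times_quat of_real_quat power2_eq_square algebra_simps)
qed

lemma slice_pt_nonreal_iff:
  assumes "I \<in> imag_units"
  shows "slice_pt I (x, y) \<in> nonreal \<longleftrightarrow> y \<noteq> 0"
proof -
  have "qim (slice_pt I (x, y)) = y *\<^sub>R I"
    using imag_units_sum_squares(1)[OF assms]
    by (simp add: slice_pt_def qim_def times_quat of_real_quat quat_eq_iff)
  moreover have "I \<noteq> 0" using assms by (auto simp: imag_units_iff)
  ultimately show ?thesis by (auto simp: nonreal_def simp flip: qim_eq_0_iff)
qed

lemma slice_dom_nonreal:
  "I \<in> imag_units \<Longrightarrow> slice_dom I nonreal = {p. snd p \<noteq> 0}"
  by (auto simp: slice_dom_def slice_pt_nonreal_iff)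

text \<open>The lower half of the slice of \<open>I\<close> is the upper half of the slice of \<open>- I\<close>.\<close>

lemma slice_pt_uminus: "slice_pt (- I) (x, y) = slice_pt I (x, - y)"
  by (simp add: slice_pt_def)

lemma uminus_imag_units: "I \<in> imag_units \<Longrightarrow> - I \<in> imag_units"
  by (simp add: imag_units_iff)

lemma imag_unit_slice_pt:
  assumes "I \<in> imag_units" "y > 0"
  shows "imag_unit (slice_pt I (x, y)) = I" "slice_coord (slice_pt I (x, y)) = (x, y)"
proof -
  have "qim (slice_pt I (x, y)) = y *\<^sub>R I" "qre (slice_pt I (x, y)) = x"
    using imag_units_sum_squares(1)[OF assms(1)]
    by (simp_all add: slice_pt_def qim_def times_quat of_real_quat quat_eq_iff)
  then show "imag_unit (slice_pt I (x, y)) = I" "slice_coord (slice_pt I (x, y)) = (x, y)"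
    using assms by (simp_all add: imag_unit_def slice_coord_def imag_units_iff)
qed

lemma C1_on_if_cont_partials_on:
  assumes "cont_partials_on D g" "open D"
  shows "C1_on D g (pdx g) (pdy g)"
proof (rule C1_onI_partials)
  fix x y assume "(x, y) \<in> D"
  with assms(1) have "(\<lambda>t. g (t, y)) differentiable at x" "(\<lambda>t. g (x, t)) differentiable at y"
    unfolding cont_partials_on_def by auto
  then show "((\<lambda>t. g (t, y)) has_vector_derivative pdx g (x, y)) (at x)"
    "((\<lambda>t. g (x, t)) has_vector_derivative pdy g (x, y)) (at y)"
    by (auto simp: pdx_def pdy_def vector_derivative_works[symmetric])
qed (use assms in \<open>auto simp: cont_partials_on_def\<close>)

lemma cont_partials_onI:
  assumes "C1_on D g gx gy" "open D"
  shows "cont_partials_on D g" "\<And>p. p \<in> D \<Longrightarrow> pdx g p = gx p" "\<And>p. p \<in> D \<Longrightarrow> pdy g p = gy p"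
proof -
  show x: "pdx g p = gx p" if "p \<in> D" for p
    using C1_on_partials(1)[OF assms(1), of "fst p" "snd p"] that
    by (cases p) (simp add: pdx_def vector_derivative_at)
  show y: "pdy g p = gy p" if "p \<in> D" for p
    using C1_on_partials(2)[OF assms(1), of "fst p" "snd p"] that
    by (cases p) (simp add: pdy_def vector_derivative_at)
  have "continuous_on D (pdx g)" "continuous_on D (pdy g)"
    using C1_onD(2,3)[OF assms(1)] x y by (simp_all cong: continuous_on_cong)
  then show "cont_partials_on D g"
    unfolding cont_partials_on_def
    using C1_on_partials[OF assms(1), THEN differentiableI_vector] by auto
qed

section \<open>Square integrability on almost every slice\<close>

text \<open>Fubini's theorem and the substitution \<open>r = e^(s + u)\<close> in the radial variable.\<close>

lemma integral_log_polar_le: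
  fixes \<rho> :: "real \<times> real \<Rightarrow> real" and j :: "real \<Rightarrow> ennreal"
  assumes c: "continuous_on ({0<..<pi} \<times> {0<..}) \<rho>"
    and pos: "\<And>\<theta> r. 0 < \<theta> \<Longrightarrow> \<theta> < pi \<Longrightarrow> 0 < r \<Longrightarrow> 0 \<le> \<rho> (\<theta>, r)"
    and j [measurable]: "j \<in> borel_measurable borel"
    and le: "\<And>\<theta>. 0 < \<theta> \<Longrightarrow> \<theta> < pi \<Longrightarrow> (\<integral>\<^sup>+ r. ennreal (\<rho> (\<theta>, r)) * indicator {0<..} r \<partial>lborel) \<le> j \<theta>"
    and \<delta>: "0 < \<delta>" "\<delta> < \<theta>" "\<theta> < pi - \<delta>"
  shows "ennreal (integral (cbox (- \<delta>, - \<delta>) (\<delta>, \<delta>))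
      (\<lambda>q. \<rho> (\<theta> + snd q, exp (s + fst q)) * exp (s + fst q))) \<le> (\<integral>\<^sup>+ \<theta>. j \<theta> \<partial>lborel)"
proof -
  let ?Q = "cbox (- \<delta>, - \<delta>) (\<delta>, \<delta>)"
  let ?g = "\<lambda>q. \<rho> (\<theta> + snd q, exp (s + fst q)) * exp (s + fst q)"
  define h where "h q = (if q \<in> ?Q then ?g q else 0)" for q
  have mem: "(\<theta> + v, r) \<in> {0<..<pi} \<times> {0<..}" if "\<bar>v\<bar> \<le> \<delta>" "0 < r" for v r
    using that \<delta> by auto
  have cg: "continuous_on ?Q ?g"
  proof (intro continuous_on_mult)
    show "continuous_on ?Q (\<lambda>q. \<rho> (\<theta> + snd q, exp (s + fst q)))"
      by (rule continuous_on_compose2[OF c])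
        (use \<delta> in \<open>auto intro!: continuous_intros simp: cbox_Pair_eq\<close>)
  qed (intro continuous_intros)
  have h0: "h q \<ge> 0" for q
    unfolding h_def using \<delta> by (cases q) (auto simp: cbox_Pair_eq intro!: pos mult_nonneg_nonneg)
  have "h = (\<lambda>q. indicator ?Q q *\<^sub>R ?g q)"
    by (auto simp: h_def fun_eq_iff indicator_def)
  then have hm [measurable]: "h \<in> borel_measurable borel"
    using borel_measurable_continuous_on_indicator[OF _ cg] by simp
  have "(?g has_integral integral ?Q ?g) ?Q"
    by (intro integrable_integral integrable_continuous cg)
  then have "(h has_integral integral ?Q ?g) UNIV"
    unfolding h_def by (simp only: has_integral_restrict_UNIV)
  from nn_integral_has_integral_lborel[OF hm h0 this]
  have "ennreal (integral ?Q ?g) = (\<integral>\<^sup>+ q. ennreal (h q) \<partial>lborel)" by simp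
  also have "\<dots> = (\<integral>\<^sup>+ q. ennreal (h q) \<partial>(lborel \<Otimes>\<^sub>M lborel))"
    by (simp add: lborel_prod)
  also have "\<dots> = (\<integral>\<^sup>+ v. \<integral>\<^sup>+ u. ennreal (h (u, v)) \<partial>lborel \<partial>lborel)"
    by (rule lborel_pair.nn_integral_snd[symmetric]) (simp add: lborel_prod)
  also have "\<dots> \<le> (\<integral>\<^sup>+ v. j (\<theta> + v) \<partial>lborel)"
  proof (rule nn_integral_mono)
    fix v :: real
    show "(\<integral>\<^sup>+ u. ennreal (h (u, v)) \<partial>lborel) \<le> j (\<theta> + v)"
    proof (cases "\<bar>v\<bar> \<le> \<delta>")
      case False
      then have "h (u, v) = 0" for u by (auto simp: h_def cbox_Pair_eq)
      then show ?thesis by simp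
    next
      case True
      let ?f = "\<lambda>r. \<rho> (\<theta> + v, r)"
      have rpos: "0 < r" if "exp (s - \<delta>) \<le> r" for r
        by (rule less_le_trans[OF exp_gt_zero that])
      have "continuous_on {exp (s - \<delta>)..exp (s + \<delta>)} ?f"
        by (rule continuous_on_compose2[OF c])
          (use mem[OF True zero_less_one] rpos in \<open>auto intro!: continuous_intros\<close>)
      then have fm: "set_borel_measurable borel {exp (s - \<delta>)..exp (s + \<delta>)} ?f"
        by (intro set_measurable_continuous_on) auto
      have "(\<integral>\<^sup>+ u. ennreal (h (u, v)) \<partial>lborel) =
          (\<integral>\<^sup>+ u. ennreal (?f (exp (s + u)) * exp (s + u) * indicator {- \<delta>..\<delta>} u) \<partial>lborel)"
        using True by (intro nn_integral_cong) (auto simp: h_def cbox_Pair_eq indicator_def)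
      also have "\<dots> = (\<integral>\<^sup>+ r. ennreal (?f r * indicator {exp (s + - \<delta>)..exp (s + \<delta>)} r) \<partial>lborel)"
        by (rule nn_integral_substitution[symmetric])
          (use fm \<delta> in \<open>auto intro!: derivative_eq_intros continuous_intros\<close>)
      also have "\<dots> \<le> (\<integral>\<^sup>+ r. ennreal (?f r) * indicator {0<..} r \<partial>lborel)"
        by (intro nn_integral_mono) (auto simp: indicator_def rpos)
      also have "\<dots> \<le> j (\<theta> + v)"
        using mem[OF True zero_less_one] by (intro le) auto
      finally show ?thesis .
    qed
  qed
  also have "\<dots> = (\<integral>\<^sup>+ v. j v \<partial>lborel)"
    using nn_integral_real_affine[OF j, of 1 \<theta>] by simp
  finally show ?thesis .
qed

text \<open>The inner integral in the formula for integrals over the weighted slice measure. The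
  first indicator of the non-real points belongs to the integrand, which in general is Borel
  measurable only after this truncation.\<close>

definition slice_energy_at :: "(quat \<Rightarrow> quat) \<Rightarrow> quat \<Rightarrow> real \<Rightarrow> ennreal"
  where "slice_energy_at f I \<theta> = (\<integral>\<^sup>+ r. ennreal r * indicator ({0..2*pi} \<times> {0..}) (\<theta>, r) *
    (ennreal (exp (- (norm (slice_polar (I, \<theta>, r)))\<^sup>2)) *
      (ennreal ((norm (f (slice_polar (I, \<theta>, r))))\<^sup>2) * indicator nonreal (slice_polar (I, \<theta>, r))) *
      indicator nonreal (slice_polar (I, \<theta>, r))) \<partial>lborel)"

definition slice_energy :: "(quat \<Rightarrow> quat) \<Rightarrow> quat \<Rightarrow> ennreal"
  where "slice_energy f I = (\<integral>\<^sup>+ \<theta>. slice_energy_at f I \<theta> \<partial>lborel)"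

lemma measurable_norm_square_nonreal:
  assumes "continuous_on nonreal (f :: quat \<Rightarrow> quat)"
  shows "(\<lambda>q. ennreal ((norm (f q))\<^sup>2) * indicator nonreal q) \<in> borel_measurable borel"
proof -
  have "(\<lambda>q. indicator nonreal q *\<^sub>R (norm (f q))\<^sup>2) \<in> borel_measurable borel"
    by (intro borel_measurable_continuous_on_indicator nonreal_borel continuous_intros assms)
  then have "(\<lambda>q. ennreal (indicator nonreal q *\<^sub>R (norm (f q))\<^sup>2)) \<in> borel_measurable borel"
    by measurable
  moreover have "(\<lambda>q. ennreal (indicator nonreal q *\<^sub>R (norm (f q))\<^sup>2)) =
      (\<lambda>q. ennreal ((norm (f q))\<^sup>2) * indicator nonreal q)"
    by (auto simp: fun_eq_iff indicator_def)
  ultimately show ?thesis by (simp only:)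
qed

lemma measurable_slice_energy_integrand:
  assumes "continuous_on nonreal (f :: quat \<Rightarrow> quat)"
  shows "(\<lambda>(I, \<theta>, r). ennreal r * indicator ({0..2*pi} \<times> {0..}) (\<theta>, r) *
    (ennreal (exp (- (norm (slice_polar (I, \<theta>, r)))\<^sup>2)) *
      (ennreal ((norm (f (slice_polar (I, \<theta>, r))))\<^sup>2) * indicator nonreal (slice_polar (I, \<theta>, r))) *
      indicator nonreal (slice_polar (I, \<theta>, r)))) \<in> borel_measurable (borel \<Otimes>\<^sub>M (borel \<Otimes>\<^sub>M borel))"
proof -
  note m1 = measurable_compose[OF measurable_slice_polar measurable_norm_square_nonreal[OF assms]]
  have m2: "(\<lambda>p. indicator nonreal (slice_polar p) :: ennreal) \<in> borel_measurable (borel \<Otimes>\<^sub>M (borel \<Otimes>\<^sub>M borel))"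
    by (rule measurable_compose[OF measurable_slice_polar]) (intro borel_measurable_indicator nonreal_borel)
  have m3: "(\<lambda>p. ennreal (exp (- (norm (slice_polar p))\<^sup>2))) \<in> borel_measurable (borel \<Otimes>\<^sub>M (borel \<Otimes>\<^sub>M borel))"
    by (rule measurable_compose[OF measurable_slice_polar]) simp
  have m4: "(\<lambda>p. ennreal (snd (snd p)) :: ennreal) \<in> borel_measurable ((borel :: quat measure) \<Otimes>\<^sub>M ((borel :: real measure) \<Otimes>\<^sub>M borel))"
    by measurable
  have m5: "(\<lambda>p. indicator ({0..2*pi} \<times> {0..}) (snd p) :: ennreal) \<in>
      borel_measurable ((borel :: quat measure) \<Otimes>\<^sub>M ((borel :: real measure) \<Otimes>\<^sub>M (borel :: real measure)))"
    by (rule measurable_compose[OF measurable_snd]) (intro borel_measurable_indicator pair_measureI, auto)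
  show ?thesis
    using borel_measurable_times_ennreal[OF borel_measurable_times_ennreal[OF m4 m5]
      borel_measurable_times_ennreal[OF borel_measurable_times_ennreal[OF m3 m1] m2]]
    by (simp add: case_prod_unfold)
qed

lemma measurable_slice_energy_at2:
  assumes "continuous_on nonreal (f :: quat \<Rightarrow> quat)"
  shows "(\<lambda>(I, \<theta>). slice_energy_at f I \<theta>) \<in> borel_measurable (borel \<Otimes>\<^sub>M borel)"
proof -
  have "(\<lambda>((I, \<theta>), r). (I, \<theta>, r)) \<in> measurable (((borel :: quat measure) \<Otimes>\<^sub>M (borel :: real measure)) \<Otimes>\<^sub>M lborel)
      (borel \<Otimes>\<^sub>M ((borel :: real measure) \<Otimes>\<^sub>M (borel :: real measure)))"
    by (simp add: case_prod_unfold)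
  from measurable_compose[OF this measurable_slice_energy_integrand[OF assms]]
  show ?thesis
    unfolding slice_energy_at_def case_prod_unfold
    by (intro lborel.borel_measurable_nn_integral) (simp add: case_prod_unfold)
qed

lemma measurable_slice_energy_at:
  assumes "continuous_on nonreal (f :: quat \<Rightarrow> quat)"
  shows "slice_energy_at f I \<in> borel_measurable borel"
  using measurable_compose[OF measurable_Pair1'[of I borel borel] measurable_slice_energy_at2[OF assms]]
  by simp

lemma AE_slice_energy_finite:
  assumes f: "f \<in> L2_slice" and c: "continuous_on nonreal f"
  shows "AE I in sphere_area. slice_energy f I \<noteq> \<infinity>"
proof (rule nn_integral_PInf_AE)
  have "slice_energy f \<in> borel_measurable borel"
    using measurable_slice_energy_at2[OF c] unfolding slice_energy_def[abs_def]
    by (intro lborel.borel_measurable_nn_integral) simp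
  then show "slice_energy f \<in> borel_measurable sphere_area"
    by (simp cong: measurable_cong_sets add: sets_sphere_area)
  have "integrable gauss_slice_measure (\<lambda>q. (norm (f q))\<^sup>2)" using f by (simp add: L2_slice_def)
  then have "(\<integral>\<^sup>+ q. ennreal (norm ((norm (f q))\<^sup>2)) \<partial>gauss_slice_measure) < \<infinity>"
    by (simp only: integrable_iff_bounded)
  also have "(\<integral>\<^sup>+ q. ennreal (norm ((norm (f q))\<^sup>2)) \<partial>gauss_slice_measure) =
      (\<integral>\<^sup>+ q. ennreal ((norm (f q))\<^sup>2) * indicator nonreal q \<partial>gauss_slice_measure)"
    by (rule nn_integral_cong)
      (simp add: gauss_slice_measure_def slice_measure_def space_restrict_space)
  also have "\<dots> = (\<integral>\<^sup>+ I. slice_energy f I \<partial>sphere_area)"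
    unfolding slice_energy_def slice_energy_at_def
    by (rule nn_integral_gauss_slice_measure) (rule measurable_norm_square_nonreal[OF c])
  finally show "(\<integral>\<^sup>+ I. slice_energy f I \<partial>sphere_area) \<noteq> \<infinity>" by simp
qed

text \<open>A single coordinate \<open>cpart I (f * e)\<close> is bounded by \<open>2 * norm f\<close>, whence the factor
  \<open>4\<close>. The bound is the same for all squares, which is what the uniqueness argument on the
  strip requires.\<close>

lemma log_polar_density_slice_le:
  assumes c: "continuous_on nonreal f" and I: "I \<in> imag_units" and fin: "slice_energy f I \<noteq> \<infinity>"
    and e: "e \<in> quat_units" and \<delta>: "0 < \<delta>" "\<delta> < \<theta>" "\<theta> < pi - \<delta>"
  shows "integral (cbox (- \<delta>, - \<delta>) (\<delta>, \<delta>)) (\<lambda>q. log_polar_density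
      (\<lambda>p. cpart I (slice_restr I f (exp (fst p) * cos (snd p), exp (fst p) * sin (snd p)) * e))
      (s + fst q, \<theta> + snd q)) \<le> enn2real (4 * slice_energy f I)"
proof -
  define \<rho> where "\<rho> p = (norm (cpart I (f (slice_pt I (snd p * cos (fst p), snd p * sin (fst p))) * e)))\<^sup>2 *
    exp (- (snd p)\<^sup>2) * snd p" for p :: "real \<times> real"
  have nr: "slice_pt I (r * cos \<theta>, r * sin \<theta>) \<in> nonreal" if "0 < \<theta>" "\<theta> < pi" "0 < r" for \<theta> r
    using that I sin_gt_zero[of \<theta>] by (simp add: slice_pt_nonreal_iff)
  have "continuous_on ({0<..<pi} \<times> {0<..}) (\<lambda>p. f (slice_pt I (snd p * cos (fst p), snd p * sin (fst p))))"
    by (rule continuous_on_compose2[OF c])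
      (auto simp: slice_pt_def nr[unfolded slice_pt_def, simplified] intro!: continuous_intros)
  then have c\<rho>: "continuous_on ({0<..<pi} \<times> {0<..}) \<rho>"
    unfolding \<rho>_def
    by (intro continuous_intros bounded_linear.continuous_on[OF bounded_linear_cpart])
  have "ennreal (integral (cbox (- \<delta>, - \<delta>) (\<delta>, \<delta>))
      (\<lambda>q. \<rho> (\<theta> + snd q, exp (s + fst q)) * exp (s + fst q))) \<le> (\<integral>\<^sup>+ \<theta>. 4 * slice_energy_at f I \<theta> \<partial>lborel)"
  proof (rule integral_log_polar_le[OF c\<rho> _ _ _ \<delta>])
    show "0 \<le> \<rho> (\<theta>, r)" if "0 < r" for \<theta> r using that by (simp add: \<rho>_def)
    show "(\<lambda>\<theta>. 4 * slice_energy_at f I \<theta>) \<in> borel_measurable borel"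
      using measurable_slice_energy_at[OF c] by measurable
  next
    fix \<theta> :: real assume \<theta>: "0 < \<theta>" "\<theta> < pi"
    have "(\<integral>\<^sup>+ r. ennreal (\<rho> (\<theta>, r)) * indicator {0<..} r \<partial>lborel) \<le>
      (\<integral>\<^sup>+ r. 4 * (ennreal r * indicator ({0..2*pi} \<times> {0..}) (\<theta>, r) *
    (ennreal (exp (- (norm (slice_polar (I, \<theta>, r)))\<^sup>2)) *
      (ennreal ((norm (f (slice_polar (I, \<theta>, r))))\<^sup>2) * indicator nonreal (slice_polar (I, \<theta>, r))) *
      indicator nonreal (slice_polar (I, \<theta>, r)))) \<partial>lborel)"
    proof (intro nn_integral_mono)
      fix r :: real
      let ?q = "slice_pt I (r * cos \<theta>, r * sin \<theta>)"
      show "ennreal (\<rho> (\<theta>, r)) * indicator {0<..} r \<le>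
        4 * (ennreal r * indicator ({0..2*pi} \<times> {0..}) (\<theta>, r) *
        (ennreal (exp (- (norm (slice_polar (I, \<theta>, r)))\<^sup>2)) *
        (ennreal ((norm (f (slice_polar (I, \<theta>, r))))\<^sup>2) * indicator nonreal (slice_polar (I, \<theta>, r))) *
        indicator nonreal (slice_polar (I, \<theta>, r))))"
      proof (cases "0 < r")
        case True
        have "norm (cpart I (f ?q * e)) \<le> 2 * norm (f ?q)"
          using norm_cpart_le[OF I, of "f ?q * e"] norm_quat_units[OF e] by (simp add: norm_mult)
        then have "(norm (cpart I (f ?q * e)))\<^sup>2 \<le> (2 * norm (f ?q))\<^sup>2" by (intro power_mono) auto
        then have "\<rho> (\<theta>, r) \<le> (2 * norm (f ?q))\<^sup>2 * exp (- r\<^sup>2) * r"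
          unfolding \<rho>_def fst_conv snd_conv using True by (intro mult_right_mono) auto
        also have "\<dots> = 4 * (r * (exp (- r\<^sup>2) * (norm (f ?q))\<^sup>2))"
          by (simp add: power_mult_distrib)
        finally have "ennreal (\<rho> (\<theta>, r)) \<le> ennreal (4 * (r * (exp (- r\<^sup>2) * (norm (f ?q))\<^sup>2)))"
          by (rule ennreal_leI)
        also have "\<dots> = 4 * (ennreal r * (ennreal (exp (- r\<^sup>2)) * ennreal ((norm (f ?q))\<^sup>2)))"
          using True by (simp add: ennreal_mult)
        finally have *: "ennreal (\<rho> (\<theta>, r)) \<le> 4 * (ennreal r * (ennreal (exp (- r\<^sup>2)) * ennreal ((norm (f ?q))\<^sup>2)))" .
        have "(norm ?q)\<^sup>2 = (r * cos \<theta>)\<^sup>2 + (r * sin \<theta>)\<^sup>2" by (rule norm_slice_pt[OF I])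
        also have "\<dots> = r\<^sup>2" by (simp add: power_mult_distrib flip: distrib_left)
        finally have n: "(norm ?q)\<^sup>2 = r\<^sup>2" .
        have sp: "slice_polar (I, \<theta>, r) = ?q" by (simp add: slice_polar_def)
        show ?thesis
          using * nr[OF \<theta> True] True \<theta> unfolding sp n by (simp add: indicator_def)
      qed simp
    qed
    also have "\<dots> = 4 * slice_energy_at f I \<theta>"
      unfolding slice_energy_at_def
    proof (rule nn_integral_cmult)
      have "(\<lambda>r. (I, \<theta>, r)) \<in> measurable lborel (borel \<Otimes>\<^sub>M ((borel :: real measure) \<Otimes>\<^sub>M (borel :: real measure)))"
        by simp
      from measurable_compose[OF this measurable_slice_energy_integrand[OF c]]
      show "(\<lambda>r. ennreal r * indicator ({0..2*pi} \<times> {0..}) (\<theta>, r) *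
        (ennreal (exp (- (norm (slice_polar (I, \<theta>, r)))\<^sup>2)) *
        (ennreal ((norm (f (slice_polar (I, \<theta>, r))))\<^sup>2) * indicator nonreal (slice_polar (I, \<theta>, r))) *
        indicator nonreal (slice_polar (I, \<theta>, r)))) \<in> borel_measurable lborel"
        by (simp only: prod.case)
    qed
    finally show "(\<integral>\<^sup>+ r. ennreal (\<rho> (\<theta>, r)) * indicator {0<..} r \<partial>lborel) \<le> 4 * slice_energy_at f I \<theta>" .
  qed
  also have "\<dots> = 4 * slice_energy f I"
    unfolding slice_energy_def using measurable_slice_energy_at[OF c]
    by (intro nn_integral_cmult) simp
  also have "(\<lambda>q. \<rho> (\<theta> + snd q, exp (s + fst q)) * exp (s + fst q)) = (\<lambda>q. log_polar_density
      (\<lambda>p. cpart I (slice_restr I f (exp (fst p) * cos (snd p), exp (fst p) * sin (snd p)) * e))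
      (s + fst q, \<theta> + snd q))"
    unfolding \<rho>_def log_polar_density_def slice_restr_def fst_conv snd_conv exp_double o_def
    by (simp add: power2_eq_square mult.assoc)
  finally have le: "ennreal (integral (cbox (- \<delta>, - \<delta>) (\<delta>, \<delta>)) (\<lambda>q. log_polar_density
      (\<lambda>p. cpart I (slice_restr I f (exp (fst p) * cos (snd p), exp (fst p) * sin (snd p)) * e))
      (s + fst q, \<theta> + snd q))) \<le> 4 * slice_energy f I" .
  have "4 * slice_energy f I < top"
    using fin by (simp add: ennreal_mult_less_top less_top)
  then have "4 * slice_energy f I = ennreal (enn2real (4 * slice_energy f I))"
    by (simp add: ennreal_enn2real)
  from ord_le_eq_trans[OF le this] show ?thesis
    by (rule iffD1[OF ennreal_le_iff[OF enn2real_nonneg]])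
qed

text \<open>Multiplied by \<open>4\<close> and seen through a complex coordinate, \<open>box f = 0\<close> becomes the
  scalar equation on the half plane.\<close>

lemma slice_dbar_zero:
  assumes f: "f \<in> box_domain" and box: "\<And>q. q \<in> nonreal \<Longrightarrow> box f q = 0"
    and I: "I \<in> imag_units" and fin: "slice_energy f I \<noteq> \<infinity>" and y: "y > 0"
  shows "pdx (slice_restr I f) (x, y) + I * pdy (slice_restr I f) (x, y) = 0"
proof (rule eq_0_if_cparts_0)
  fix e assume e: "e \<in> quat_units"
  let ?D = "{p::real \<times> real. snd p \<noteq> 0}" and ?g = "slice_restr I f"
  define L where "L q = cpart I (q * e)" for q
  have L: "bounded_linear L"
    unfolding L_def by (intro bounded_linear_compose[OF bounded_linear_cpart] bounded_linear_mult_left)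
  interpret L: bounded_linear L by (rule L)
  have LI: "L (I * q) = \<i> * L q" for q
    using cpart_mult_left[OF I, of "q * e"] by (simp add: L_def mult.assoc)
  have D: "open ?D" by (intro open_Collect_neq continuous_intros)
  have sub: "half_plane \<subseteq> ?D" by (auto simp: half_plane_def)
  have "cont_partials2_on ?D ?g"
    using f I by (auto simp: box_domain_def slice_dom_nonreal)
  then have C: "C1_on ?D ?g (pdx ?g) (pdy ?g)" "C1_on ?D (pdx ?g) (pdx (pdx ?g)) (pdy (pdx ?g))"
    "C1_on ?D (pdy ?g) (pdx (pdy ?g)) (pdy (pdy ?g))"
    unfolding cont_partials2_on_def by (auto intro: C1_on_if_cont_partials_on D)
  note C' = this[THEN C1_on_subset[OF _ sub], THEN C1_on_bounded_linear[OF _ L]]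
  have cf: "continuous_on nonreal f"
    using f by (auto simp: box_domain_def intro!: continuous_at_imp_continuous_on differentiable_imp_continuous_within)
  have "L (pdx ?g (x, y)) + \<i> * L (pdy ?g (x, y)) = 0"
  proof (rule half_plane_dbar_zero[OF C'(1) C'(2) C'(3) _ _ _ y])
    fix x y :: real assume y: "0 < y"
    let ?A = "pdx (pdx ?g) (x, y) + pdy (pdy ?g) (x, y)" and ?B = "x *\<^sub>R pdx ?g (x, y) + y *\<^sub>R pdy ?g (x, y)"
      and ?C = "x *\<^sub>R pdy ?g (x, y) - y *\<^sub>R pdx ?g (x, y)"
    have "- (1/4) *\<^sub>R ?A + (1/2) *\<^sub>R ?B + (I /\<^sub>R 2) * ?C = 0"
      using box[of "slice_pt I (x, y)"] y I
      by (simp add: box_def Let_def imag_unit_slice_pt slice_pt_nonreal_iff)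
    then have "L (- (1/4) *\<^sub>R ?A + (1/2) *\<^sub>R ?B + (1/2) *\<^sub>R (I * ?C)) = 0"
      by (simp add: L.zero)
    then have "- (1/4) *\<^sub>R L ?A + (1/2) *\<^sub>R L ?B + (1/2) *\<^sub>R (\<i> * L ?C) = 0"
      by (simp only: L.add L.scaleR LI)
    then have "L ?A = 2 * L ?B + 2 * \<i> * L ?C"
      by (simp add: scaleR_conv_of_real field_simps)
    then show "L (pdx (pdx ?g) (x, y)) + L (pdy (pdy ?g) (x, y)) =
        2 * (x *\<^sub>R L (pdx ?g (x, y)) + y *\<^sub>R L (pdy ?g (x, y))) +
        2 * \<i> * (x *\<^sub>R L (pdy ?g (x, y)) - y *\<^sub>R L (pdx ?g (x, y)))"
      by (simp only: L.add L.diff L.scaleR)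
  next
    show "integral (cbox (- \<delta>, - \<delta>) (\<delta>, \<delta>)) (\<lambda>q. log_polar_density
        (\<lambda>p. L (?g (exp (fst p) * cos (snd p), exp (fst p) * sin (snd p)))) (s + fst q, \<theta> + snd q))
        \<le> enn2real (4 * slice_energy f I)" if "0 < \<delta>" "\<delta> < \<theta>" "\<theta> < pi - \<delta>" for \<delta> s \<theta>
      unfolding L_def by (rule log_polar_density_slice_le[OF cf I fin e that])
  qed (rule enn2real_nonneg)
  then show "Re (cpart I ((pdx ?g (x, y) + I * pdy ?g (x, y)) * e)) = 0"
    by (simp add: L.add LI flip: L_def)
qed

section \<open>From almost every slice to every slice\<close>

text \<open>A property that holds almost everywhere on the sphere holds at points arbitrarily near
  \<open>I0\<close>: in spherical coordinates, \<open>I0\<close> lies in the closure of the image of an open rectangle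
  on which the area density is positive, and non-empty open sets are not negligible.\<close>

lemma AE_sphere_area_dense:
  assumes AE: "AE I in sphere_area. P I" and I0: "I0 \<in> imag_units" and e: "e > 0"
  obtains I where "I \<in> imag_units" "dist I I0 < e" "P I"
proof -
  define S where "S = (\<lambda>(\<phi>, \<psi>). Quat 0 (sin \<phi> * cos \<psi>) (sin \<phi> * sin \<psi>) (cos \<phi>))"
  have S_unit: "S p \<in> imag_units" for p
  proof (cases p)
    case (Pair \<phi> \<psi>)
    have "(sin \<phi> * cos \<psi>)\<^sup>2 + (sin \<phi> * sin \<psi>)\<^sup>2 + (cos \<phi>)\<^sup>2 = (sin \<phi>)\<^sup>2 * ((cos \<psi>)\<^sup>2 + (sin \<psi>)\<^sup>2) + (cos \<phi>)\<^sup>2"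
      by (simp only: power_mult_distrib distrib_left)
    then show ?thesis by (simp add: Pair S_def imag_units_iff norm_quat)
  qed
  have sm: "S \<in> measurable (density lborel (\<lambda>(\<phi>, \<psi>). ennreal (sin \<phi>) * indicator ({0..pi} \<times> {0..2*pi}) (\<phi>, \<psi>))) borel"
    using measurable_spherical_coords by (simp add: S_def)
  have dm: "(\<lambda>(\<phi>, \<psi>). ennreal (sin \<phi>) * indicator ({0..pi} \<times> {0..2*pi}) (\<phi>, \<psi>)) \<in> borel_measurable (lborel :: (real \<times> real) measure)"
  proof -
    have "{0..pi} \<times> {0..2*pi} \<in> sets (borel :: (real\<times>real) measure)"
      by (intro borel_closed closed_Times) auto
    moreover have "(\<lambda>x::real\<times>real. ennreal (sin (fst x))) \<in> borel_measurable borel"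
      by (intro measurable_compose[OF _ measurable_ennreal] borel_measurable_continuous_onI continuous_intros)
    ultimately show ?thesis by (simp add: case_prod_unfold)
  qed
  define Q where "Q p \<longleftrightarrow> (0 < (\<lambda>(\<phi>, \<psi>). ennreal (sin \<phi>) * indicator ({0..pi} \<times> {0..2*pi}) (\<phi>, \<psi>)) p \<longrightarrow> P (S p))" for p
  have "AE p in lborel. Q p"
    using AE_distrD[OF sm] AE unfolding sphere_area_def S_def[symmetric] Q_def
    by (simp only: AE_density[OF dm])
  then obtain N where N: "N \<in> null_sets lborel" "{p \<in> space lborel. \<not> Q p} \<subseteq> N"
    unfolding eventually_ae_filter by (elim bexE)
  define z where "z = qk I0"
  have u: "qre I0 = 0" "(qi I0)\<^sup>2 + (qj I0)\<^sup>2 + z\<^sup>2 = 1"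
    using imag_units_sum_squares[OF I0] by (simp_all add: z_def)
  have z: "-1 \<le> z" "z \<le> 1"
  proof -
    have "z\<^sup>2 \<le> 1" using u(2) by (smt (verit) zero_le_power2)
    then show "-1 \<le> z" "z \<le> 1" by (auto simp: abs_square_le_1 abs_le_iff)
  qed
  define \<phi> where "\<phi> = arccos z"
  have \<phi>: "0 \<le> \<phi>" "\<phi> \<le> pi" "cos \<phi> = z" "0 \<le> sin \<phi>"
    using z by (auto simp: \<phi>_def arccos_lbound arccos_ubound intro!: sin_ge_zero)
  have sin2: "(sin \<phi>)\<^sup>2 = (qi I0)\<^sup>2 + (qj I0)\<^sup>2"
    using u(2) sin_cos_squared_add[of \<phi>] by (simp add: \<phi>(3))
  obtain \<psi> where \<psi>: "0 \<le> \<psi>" "\<psi> \<le> 2 * pi" "qi I0 = sin \<phi> * cos \<psi>" "qj I0 = sin \<phi> * sin \<psi>"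
  proof (cases "sin \<phi> = 0")
    case True
    then have "qi I0 = 0" "qj I0 = 0" using sin2 by (auto simp: add_nonneg_eq_0_iff)
    with that[of 0] True show ?thesis by simp
  next
    case False
    have "(qi I0 / sin \<phi>)\<^sup>2 + (qj I0 / sin \<phi>)\<^sup>2 = 1"
      unfolding power_divide add_divide_distrib[symmetric] sin2[symmetric] using False by simp
    from sincos_total_2pi[OF this] obtain t where
      "0 \<le> t" "t < 2 * pi" "qi I0 / sin \<phi> = cos t" "qj I0 / sin \<phi> = sin t" by blast
    with that[of t] False show ?thesis by (simp add: field_simps)
  qed
  have SI: "S (\<phi>, \<psi>) = I0" by (simp add: S_def quat_eq_iff u \<phi> \<psi> z_def[symmetric])
  have "continuous_on UNIV S"
  proof -
    have "S = (\<lambda>z. (sin (fst z) * cos (snd z)) *\<^sub>R Quat 0 1 0 0 + (sin (fst z) * sin (snd z)) *\<^sub>R Quat 0 0 1 0 + cos (fst z) *\<^sub>R Quat 0 0 0 1)"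
      by (simp add: S_def fun_eq_iff quat_eq_iff)
    then show ?thesis by (simp only:) (intro continuous_intros)
  qed
  then have "open (S -` ball I0 e)" by (intro open_vimage) auto
  let ?B = "{0<..<pi} \<times> {0<..<2*pi}"
  let ?O = "?B \<inter> S -` ball I0 e"
  have opO: "open ?O" using \<open>open (S -` ball I0 e)\<close> by (intro open_Int open_Times) auto
  \<comment> \<open>The poles and the meridian \<open>\<psi> = 0\<close> lie on the boundary of the rectangle.\<close>
  have "(\<phi>, \<psi>) \<in> closure ?B"
    using \<phi> \<psi> by (simp add: closure_Times closure_greaterThanLessThan)
  moreover have "(\<phi>, \<psi>) \<in> S -` ball I0 e" using e SI by simp
  ultimately have ne: "?O \<noteq> {}"
    using \<open>open (S -` ball I0 e)\<close> by (metis Int_commute disjoint_iff open_Int_closure_eq_empty)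
  have "\<not> ?O \<subseteq> N"
  proof
    assume "?O \<subseteq> N"
    then have "?O \<in> null_sets lborel"
      using opO by (intro null_sets_subset[OF N(1)]) auto
    then have "negligible ?O" by (simp add: negligible_iff_null_sets null_sets_completionI)
    then show False using open_not_negligible[OF opO ne] by simp
  qed
  then obtain p where p: "p \<in> ?O" "p \<notin> N" by blast
  have "0 < (\<lambda>(\<phi>, \<psi>). ennreal (sin \<phi>) * indicator ({0..pi} \<times> {0..2*pi}) (\<phi>, \<psi>)) p"
    using p(1) by (auto simp: sin_gt_zero)
  moreover have "Q p" using N(2) p(2) by auto
  ultimately have "P (S p)" unfolding Q_def by (rule rev_mp)
  with that[of "S p"] p(1) S_unit[of p] show thesis by (auto simp: dist_commute)
qed

definition slice_coeff :: "(quat \<Rightarrow> quat) \<Rightarrow> quat \<Rightarrow> quat \<Rightarrow> complex \<Rightarrow> complex"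
  where "slice_coeff f I e z = cpart I (slice_restr I f (Re z, Im z) * e)"

lemma bounded_linear_cpart_mult: "bounded_linear (\<lambda>q. cpart I (q * e))"
  by (intro bounded_linear_compose[OF bounded_linear_cpart] bounded_linear_mult_left)

lemma slice_coeff_field_derivative:
  assumes C: "C1_on D (slice_restr I f) gx gy" and I: "I \<in> imag_units"
    and CR: "gx (Re z, Im z) + I * gy (Re z, Im z) = 0" and z: "(Re z, Im z) \<in> D"
  shows "(slice_coeff f I e has_field_derivative cpart I (gx (Re z, Im z) * e)) (at z)"
proof -
  interpret L: bounded_linear "\<lambda>q. cpart I (q * e)" by (rule bounded_linear_cpart_mult)
  have "cpart I (gx (Re z, Im z) * e) + \<i> * cpart I (gy (Re z, Im z) * e) = cpart I ((gx (Re z, Im z) + I * gy (Re z, Im z)) * e)"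
    using cpart_mult_left[OF I, of "gy (Re z, Im z) * e"] by (simp add: L.add mult.assoc)
  also have "\<dots> = 0" using CR L.zero by simp
  finally show ?thesis
    using C1_on_Cauchy_Riemann[OF C1_on_bounded_linear[OF C bounded_linear_cpart_mult] _ z]
    by (simp add: slice_coeff_def[abs_def])
qed

lemma dbar_zero_if_slice_coeffs_holomorphic:
  assumes C: "C1_on D (slice_restr I f) gx gy" and I: "I \<in> imag_units"
    and holo: "\<And>e. e \<in> quat_units \<Longrightarrow> slice_coeff f I e holomorphic_on S"
    and S: "open S" "Complex x y \<in> S" and D: "(x, y) \<in> D"
  shows "gx (x, y) + I * gy (x, y) = 0"
proof (rule eq_0_if_cparts_0)
  fix e assume e: "e \<in> quat_units"
  interpret L: bounded_linear "\<lambda>q. cpart I (q * e)" by (rule bounded_linear_cpart_mult)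
  note C' = C1_on_bounded_linear[OF C bounded_linear_cpart_mult[of I e]]
  define d where "d = deriv (slice_coeff f I e) (Complex x y)"
  have d: "(slice_coeff f I e has_derivative (*) d) (at (Complex x y))"
    using holomorphic_derivI[OF holo[OF e] S] by (simp add: d_def has_field_derivative_def)
  have "((\<lambda>t. Complex t y) has_derivative (\<lambda>h. of_real h)) (at x)"
    "((\<lambda>t. Complex x t) has_derivative (\<lambda>h. \<i> * of_real h)) (at y)"
    unfolding Complex_eq by (auto intro!: derivative_eq_intros)
  from this(1)[THEN has_derivative_compose, OF d] this(2)[THEN has_derivative_compose, OF d]
  have "((\<lambda>t. slice_coeff f I e (Complex t y)) has_vector_derivative d) (at x)"
    "((\<lambda>t. slice_coeff f I e (Complex x t)) has_vector_derivative \<i> * d) (at y)"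
    by (simp_all add: has_vector_derivative_def scaleR_conv_of_real mult_ac)
  then have "cpart I (gx (x, y) * e) = d" "cpart I (gy (x, y) * e) = \<i> * d"
    using C1_on_partials[OF C' D] by (auto simp: slice_coeff_def intro: vector_derivative_unique_at)
  then show "Re (cpart I ((gx (x, y) + I * gy (x, y)) * e)) = 0"
    using cpart_mult_left[OF I, of "gy (x, y) * e"] by (simp add: L.add mult.assoc)
qed

lemma compact_imag_units: "compact imag_units"
proof -
  have "closed {q. qre q = 0}"
    by (intro closed_Collect_eq bounded_linear.continuous_on[OF bounded_linear_qre] continuous_intros)
  then have "compact (sphere 0 1 \<inter> {q. qre q = 0})"
    by (rule compact_Int_closed[OF compact_sphere])
  also have "sphere 0 1 \<inter> {q. qre q = 0} = imag_units"
    by (auto simp: imag_units_iff)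
  finally show ?thesis .
qed

text \<open>As \<open>f\<close> is continuous, \<open>slice_coeff f J e z\<close> depends jointly continuously on \<open>J\<close> and
  \<open>z\<close>; for \<open>J\<close> near \<open>I\<close> these functions are uniformly close on compact sets, and locally
  uniform limits of holomorphic functions are holomorphic. The partial derivatives of \<open>f\<close>
  along the slices need not depend continuously on \<open>J\<close>, so the equation itself cannot be
  passed to the limit.\<close>

lemma slice_coeff_holomorphic_limit:
  assumes f: "continuous_on nonreal f"
    and dense: "\<And>\<epsilon>. \<epsilon> > 0 \<Longrightarrow> \<exists>J\<in>imag_units. dist J I < \<epsilon> \<and> slice_coeff f J e holomorphic_on {z. 0 < Im z}"
    and I: "I \<in> imag_units"
  shows "slice_coeff f I e holomorphic_on {z. 0 < Im z}"
proof -
  have "\<forall>n. \<exists>J\<in>imag_units. dist J I < inverse (real (Suc n)) \<and> slice_coeff f J e holomorphic_on {z. 0 < Im z}"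
    by (intro allI dense) simp
  then obtain J where J: "\<And>n. J n \<in> imag_units" "\<And>n. dist (J n) I < inverse (real (Suc n))"
    "\<And>n. slice_coeff f (J n) e holomorphic_on {z. 0 < Im z}" by metis
  show ?thesis
  proof (rule holomorphic_uniform_sequence[OF _ J(3)])
    show op: "open {z. 0 < Im z}" by (simp add: open_halfspace_Im_gt)
    fix z assume "z \<in> {z. 0 < Im z}"
    then obtain d where d: "d > 0" "cball z d \<subseteq> {z. 0 < Im z}"
      using op open_contains_cball by blast
    let ?K = "imag_units \<times> cball z d"
    let ?F = "\<lambda>p. slice_coeff f (fst p) e (snd p)"
    have "continuous_on ?K (\<lambda>p. f (slice_pt (fst p) (Re (snd p), Im (snd p))))"
    proof (rule continuous_on_compose2[OF f])
      show "continuous_on ?K (\<lambda>p. slice_pt (fst p) (Re (snd p), Im (snd p)))"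
        unfolding slice_pt_def by (auto intro!: continuous_intros)
      have "Im w \<noteq> 0" if "w \<in> cball z d" for w using d that by fastforce
      then show "(\<lambda>p. slice_pt (fst p) (Re (snd p), Im (snd p))) ` ?K \<subseteq> nonreal"
        by (auto simp: slice_pt_nonreal_iff)
    qed
    then have "continuous_on ?K ?F"
      unfolding slice_coeff_def cpart_def slice_restr_def o_def
      by (intro continuous_intros bounded_linear.continuous_on[OF bounded_linear_qre])
    then have uc: "uniformly_continuous_on ?K ?F"
      by (intro compact_uniformly_continuous compact_Times compact_imag_units compact_cball)
    have "uniform_limit (cball z d) (\<lambda>n. slice_coeff f (J n) e) (slice_coeff f I e) sequentially"
      unfolding uniform_limit_iff
    proof (intro allI impI)
      fix \<epsilon> :: real assume "\<epsilon> > 0"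
      with uc obtain \<eta> where \<eta>: "\<eta> > 0"
        "\<And>p p'. p \<in> ?K \<Longrightarrow> p' \<in> ?K \<Longrightarrow> dist p' p < \<eta> \<Longrightarrow> dist (?F p') (?F p) < \<epsilon>"
        unfolding uniformly_continuous_on_def by metis
      have "(\<lambda>n. inverse (real (Suc n))) \<longlonglongrightarrow> 0" by (rule LIMSEQ_inverse_real_of_nat)
      then have "\<forall>\<^sub>F n in sequentially. inverse (real (Suc n)) < \<eta>"
        using \<eta>(1) by (rule order_tendstoD)
      then show "\<forall>\<^sub>F n in sequentially. \<forall>w\<in>cball z d. dist (slice_coeff f (J n) e w) (slice_coeff f I e w) < \<epsilon>"
      proof eventually_elim
        case (elim n)
        show ?case
        proof
          fix w assume "w \<in> cball z d"
          moreover have "dist (J n) I < \<eta>" using J(2)[of n] elim by linarith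
          ultimately show "dist (slice_coeff f (J n) e w) (slice_coeff f I e w) < \<epsilon>"
            using \<eta>(2)[of "(I, w)" "(J n, w)"] I J(1) by (simp add: dist_Pair_Pair)
        qed
      qed
    qed
    with d show "\<exists>d>0. cball z d \<subseteq> {z. 0 < Im z} \<and>
        uniform_limit (cball z d) (\<lambda>n. slice_coeff f (J n) e) (slice_coeff f I e) sequentially" by blast
  qed
qed

text \<open>Almost every slice has finite energy, so \<open>f\<close> is holomorphic on a dense set of slices,
  and by continuity on all of them.\<close>

lemma upper_dbar_zero:
  assumes f: "f \<in> box_domain" and L2: "f \<in> L2_slice"
    and box: "\<And>q. q \<in> nonreal \<Longrightarrow> box f q = 0" and I: "I \<in> imag_units" and y: "y > 0"
  shows "pdx (slice_restr I f) (x, y) + I * pdy (slice_restr I f) (x, y) = 0"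
proof -
  have cf: "continuous_on nonreal f"
    using f by (auto simp: box_domain_def intro!: continuous_at_imp_continuous_on differentiable_imp_continuous_within)
  let ?D = "{p::real \<times> real. snd p \<noteq> 0}"
  have D: "open ?D" by (intro open_Collect_neq continuous_intros)
  have C: "C1_on ?D (slice_restr J f) (pdx (slice_restr J f)) (pdy (slice_restr J f))"
    if "J \<in> imag_units" for J
    using f that D by (intro C1_on_if_cont_partials_on)
      (auto simp: box_domain_def slice_dom_nonreal cont_partials2_on_def)
  have holo: "slice_coeff f J e holomorphic_on {z. 0 < Im z}"
    if J: "J \<in> imag_units" and fin: "slice_energy f J \<noteq> \<infinity>" for J e
  proof -
    have "\<exists>d. (slice_coeff f J e has_field_derivative d) (at z)" if "0 < Im z" for z
      using slice_coeff_field_derivative[OF C[OF J] J slice_dbar_zero[OF f box J fin that]] that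
      by auto
    then show ?thesis
      unfolding holomorphic_on_def field_differentiable_def by (blast intro: has_field_derivative_at_within)
  qed
  have "slice_coeff f I e holomorphic_on {z. 0 < Im z}" for e
  proof (rule slice_coeff_holomorphic_limit[OF cf _ I])
    fix \<epsilon> :: real assume "\<epsilon> > 0"
    from AE_sphere_area_dense[OF AE_slice_energy_finite[OF L2 cf] I this]
    obtain J where "J \<in> imag_units" "dist J I < \<epsilon>" "slice_energy f J \<noteq> \<infinity>" by blast
    with holo[of J e] show "\<exists>J\<in>imag_units. dist J I < \<epsilon> \<and> slice_coeff f J e holomorphic_on {z. 0 < Im z}"
      by blast
  qed
  then show ?thesis
    by (rule dbar_zero_if_slice_coeffs_holomorphic[OF C[OF I] I _ open_halfspace_Im_gt[of 0]]) (use y in auto)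
qed

text \<open>Reflection \<open>y \<mapsto> - y\<close> exchanges \<open>I\<close> and \<open>- I\<close> and changes the sign of \<open>\<partial>\<^sub>y\<close>, so the
  Cauchy--Riemann expression is invariant.\<close>

lemma dbar_reflect:
  assumes C: "C1_on D (slice_restr I f) (pdx (slice_restr I f)) (pdy (slice_restr I f))"
    and D: "(x, y) \<in> D"
    and z: "pdx (slice_restr (- I) f) (x, - y) + (- I) * pdy (slice_restr (- I) f) (x, - y) = 0"
  shows "pdx (slice_restr I f) (x, y) + I * pdy (slice_restr I f) (x, y) = 0"
proof -
  have r: "slice_restr (- I) f (u, v) = slice_restr I f (u, - v)" for u v
    by (simp add: slice_restr_def slice_pt_uminus)
  have "pdx (slice_restr (- I) f) (x, - y) = pdx (slice_restr I f) (x, y)"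
    by (simp add: pdx_def r)
  moreover have "pdy (slice_restr (- I) f) (x, - y) = - pdy (slice_restr I f) (x, y)"
  proof -
    have "((\<lambda>t. slice_restr I f (x, - t)) has_vector_derivative
        0 *\<^sub>R pdx (slice_restr I f) (x, - (- y)) + (- 1) *\<^sub>R pdy (slice_restr I f) (x, - (- y))) (at (- y))"
      by (rule C1_on_compose_path[OF C]) (use D in \<open>auto intro!: derivative_eq_intros\<close>)
    then have "vector_derivative (\<lambda>t. slice_restr I f (x, - t)) (at (- y)) = - pdy (slice_restr I f) (x, y)"
      by (simp add: vector_derivative_at)
    then show ?thesis by (simp add: pdy_def r)
  qed
  ultimately show ?thesis using z by simp
qed

section \<open>Slice regular functions solve the equation\<close>

text \<open>A left inverse of the coordinates \<open>e \<mapsto> cpart I (q * e)\<close>.\<close>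

definition recompose :: "(quat \<Rightarrow> complex) \<Rightarrow> quat"
  where "recompose a = Re (a 1) *\<^sub>R 1 - Re (a (Quat 0 1 0 0)) *\<^sub>R Quat 0 1 0 0
    - Re (a (Quat 0 0 1 0)) *\<^sub>R Quat 0 0 1 0 - Re (a (Quat 0 0 0 1)) *\<^sub>R Quat 0 0 0 1"

lemma recompose_slice_coeff: "recompose (\<lambda>e. slice_coeff f I e (Complex x y)) = slice_restr I f (x, y)"
  by (simp add: recompose_def slice_coeff_def cpart_def quat_eq_iff times_quat one_quat)

lemma C1_on_holomorphic:
  assumes A: "A holomorphic_on {z. Im z \<noteq> 0}"
  shows "C1_on {p. snd p \<noteq> 0} (\<lambda>p. A (Complex (fst p) (snd p)))
    (\<lambda>p. deriv A (Complex (fst p) (snd p))) (\<lambda>p. \<i> * deriv A (Complex (fst p) (snd p)))"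
proof -
  have S: "open {z. Im z \<noteq> 0}" by (intro open_Collect_neq continuous_intros)
  have c: "continuous_on {p. snd p \<noteq> 0} (\<lambda>p. deriv A (Complex (fst p) (snd p)))"
    by (rule continuous_on_compose2[OF holomorphic_on_imp_continuous_on[OF holomorphic_deriv[OF A S]]])
      (auto intro!: continuous_intros)
  have "((\<lambda>p. A (Complex (fst p) (snd p))) has_derivative
      (\<lambda>h. fst h *\<^sub>R deriv A (Complex (fst p) (snd p)) + snd h *\<^sub>R (\<i> * deriv A (Complex (fst p) (snd p))))) (at p)"
    if "snd p \<noteq> 0" for p
  proof -
    have "(A has_derivative (*) (deriv A (Complex (fst p) (snd p)))) (at (Complex (fst p) (snd p)))"
      using holomorphic_derivI[OF A S, of "Complex (fst p) (snd p)"] that by (simp add: has_field_derivative_def)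
    moreover have "((\<lambda>p. Complex (fst p) (snd p)) has_derivative (\<lambda>h. of_real (fst h) + \<i> * of_real (snd h))) (at p)"
      unfolding Complex_eq by (auto intro!: derivative_eq_intros)
    ultimately have "((\<lambda>p. A (Complex (fst p) (snd p))) has_derivative
        (\<lambda>h. deriv A (Complex (fst p) (snd p)) * (of_real (fst h) + \<i> * of_real (snd h)))) (at p)"
      by (rule has_derivative_compose[rotated])
    then show ?thesis by (simp add: scaleR_conv_of_real algebra_simps)
  qed
  then show ?thesis using c by (auto simp: C1_on_def intro!: continuous_intros)
qed

text \<open>Functions with holomorphic coordinates are closed under both partial derivatives,
  which act on the coordinates as \<open>d/dz\<close> and \<open>\<i> d/dz\<close>. Iteration gives all second
  derivatives.\<close>

lemma C1_on_recompose:
  assumes A: "\<And>e. A e holomorphic_on {z. Im z \<noteq> 0}"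
  shows "C1_on {p. snd p \<noteq> 0} (\<lambda>p. recompose (\<lambda>e. A e (Complex (fst p) (snd p))))
    (\<lambda>p. recompose (\<lambda>e. deriv (A e) (Complex (fst p) (snd p))))
    (\<lambda>p. recompose (\<lambda>e. \<i> * deriv (A e) (Complex (fst p) (snd p))))"
proof -
  have L: "bounded_linear (\<lambda>z. Re z *\<^sub>R e)" for e :: quat
    by (intro bounded_linear_compose[OF bounded_linear_scaleR_left] bounded_linear_Re)
  show ?thesis
    unfolding recompose_def
    by (intro C1_on_diff C1_on_bounded_linear[OF C1_on_holomorphic[OF A] L])
qed

text \<open>The coordinates of a slice regular function are holomorphic, hence smooth, and
  harmonic because \<open>\<i>\<^sup>2 = - 1\<close>: the second order part of \<open>box f\<close> vanishes. The first order
  part is \<open>cnj q / 2\<close> times the Cauchy--Riemann expression \<open>\<partial>\<^sub>x f + I \<partial>\<^sub>y f\<close>.\<close>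

lemma slice_regular_nonreal_box:
  assumes f: "f \<in> slice_regular nonreal"
  shows "f \<in> box_domain" and "\<And>q. q \<in> nonreal \<Longrightarrow> box f q = 0"
proof -
  let ?D = "{p::real \<times> real. snd p \<noteq> 0}" and ?S = "{z. Im z \<noteq> 0}"
  have D: "open ?D" by (intro open_Collect_neq continuous_intros)
  have S: "open ?S" by (intro open_Collect_neq continuous_intros)
  have main: "cont_partials2_on ?D (slice_restr I f) \<and>
      (\<forall>p\<in>?D. pdx (pdx (slice_restr I f)) p + pdy (pdy (slice_restr I f)) p = 0 \<and>
        pdx (slice_restr I f) p + I * pdy (slice_restr I f) p = 0)"
    if I: "I \<in> imag_units" for I
  proof -
    let ?g = "slice_restr I f"
    have cp: "cont_partials_on ?D ?g" and CR: "\<And>p. p \<in> ?D \<Longrightarrow> pdx ?g p + I * pdy ?g p = 0"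
      using f I by (auto simp: slice_regular_def slice_dom_nonreal)
    define A where "A = slice_coeff f I"
    define A1 where "A1 e = deriv (A e)" for e
    define B1 where "B1 e z = \<i> * deriv (A e) z" for e z
    have A: "A e holomorphic_on ?S" for e
    proof -
      have "\<exists>d. (A e has_field_derivative d) (at z)" if "Im z \<noteq> 0" for z
        using slice_coeff_field_derivative[OF C1_on_if_cont_partials_on[OF cp D] I CR] that
        unfolding A_def by auto
      then show ?thesis
        unfolding holomorphic_on_def field_differentiable_def by (blast intro: has_field_derivative_at_within)
    qed
    have A1: "A1 e holomorphic_on ?S" for e
      unfolding A1_def by (rule holomorphic_deriv[OF A S])
    have B1: "B1 e holomorphic_on ?S" for e
      unfolding B1_def by (intro holomorphic_intros holomorphic_deriv[OF A S])
    have g: "?g = (\<lambda>p. recompose (\<lambda>e. A e (Complex (fst p) (snd p))))"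
      by (auto simp: fun_eq_iff A_def recompose_slice_coeff)
    note g1 = cont_partials_onI[OF C1_on_recompose[where A=A, OF A, folded g] D]
    have "C1_on ?D (pdx ?g) (\<lambda>p. recompose (\<lambda>e. deriv (A1 e) (Complex (fst p) (snd p))))
        (\<lambda>p. recompose (\<lambda>e. \<i> * deriv (A1 e) (Complex (fst p) (snd p))))"
      by (rule C1_on_cong[OF C1_on_recompose[OF A1] D]) (use g1(2) in \<open>simp add: A1_def\<close>)
    note gx = cont_partials_onI[OF this D]
    have "C1_on ?D (pdy ?g) (\<lambda>p. recompose (\<lambda>e. deriv (B1 e) (Complex (fst p) (snd p))))
        (\<lambda>p. recompose (\<lambda>e. \<i> * deriv (B1 e) (Complex (fst p) (snd p))))"
      by (rule C1_on_cong[OF C1_on_recompose[OF B1] D]) (use g1(3) in \<open>simp add: B1_def\<close>)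
    note gy = cont_partials_onI[OF this D]
    have dB: "deriv (B1 e) z = \<i> * deriv (A1 e) z" if "z \<in> ?S" for e z
      unfolding B1_def A1_def
      by (rule deriv_cmult) (rule holomorphic_on_imp_differentiable_at[OF holomorphic_deriv[OF A S] S that])
    have "pdx (pdx ?g) p + pdy (pdy ?g) p = 0" if "p \<in> ?D" for p
      using that gx(2)[OF that] gy(3)[OF that] by (simp add: dB recompose_def)
    then show ?thesis
      using g1(1) gx(1) gy(1) CR by (simp add: cont_partials2_on_def)
  qed
  show "f \<in> box_domain"
    using f main by (auto simp: box_domain_def slice_regular_def slice_dom_nonreal)
  show "box f q = 0" if q: "q \<in> nonreal" for q
  proof -
    let ?I = "imag_unit q" let ?z = "slice_coord q" let ?g = "slice_restr ?I f"
    have I: "?I \<in> imag_units" by (rule imag_unit_in_imag_units[OF q])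
    have z: "?z \<in> ?D" using q by (auto simp: slice_coord_def nonreal_def qim_eq_0_iff)
    have 1: "pdx (pdx ?g) ?z + pdy (pdy ?g) ?z = 0" "pdx ?g ?z = - (?I * pdy ?g ?z)"
      using main[OF I, THEN conjunct2, THEN bspec, OF z] by (simp_all add: eq_neg_iff_add_eq_0)
    have II: "?I * (?I * p) = - p" for p
      using I by (simp add: imag_units_def power2_eq_square flip: mult.assoc)
    show ?thesis
      unfolding box_def Let_def 1 by (simp add: algebra_simps II)
  qed
qed

section \<open>The eigenspace for the eigenvalue zero\<close>

theorem corollary4p9:
  shows "fock_eigenspace 0 = fock_full"
proof (intro equalityI subsetI)
  fix f assume "f \<in> fock_eigenspace 0"
  then have f: "f \<in> box_domain" "f \<in> L2_slice" "\<And>q. q \<in> nonreal \<Longrightarrow> box f q = 0"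
    by (auto simp: fock_eigenspace_def)
  have D: "open {p::real \<times> real. snd p \<noteq> 0}" by (intro open_Collect_neq continuous_intros)
  have cp: "cont_partials_on {p. snd p \<noteq> 0} (slice_restr I f)" if "I \<in> imag_units" for I
    using f(1) that by (auto simp: box_domain_def slice_dom_nonreal cont_partials2_on_def)
  have "pdx (slice_restr I f) (x, y) + I * pdy (slice_restr I f) (x, y) = 0"
    if I: "I \<in> imag_units" and y: "y \<noteq> 0" for I x y
  proof (cases "y > 0")
    case True
    show ?thesis by (rule upper_dbar_zero[OF f I True])
  next
    case False
    with y have "- y > 0" by simp
    have "pdx (slice_restr (- I) f) (x, - y) + - I * pdy (slice_restr (- I) f) (x, - y) = 0"
      by (rule upper_dbar_zero[OF f uminus_imag_units[OF I] \<open>- y > 0\<close>])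
    with y show ?thesis
      by (intro dbar_reflect[OF C1_on_if_cont_partials_on[OF cp[OF I] D]]) auto
  qed
  then have "f \<in> slice_regular nonreal"
    using f(1) cp by (auto simp: slice_regular_def box_domain_def slice_dom_nonreal)
  with f(2) show "f \<in> fock_full" by (simp add: fock_full_def)
next
  fix f assume "f \<in> fock_full"
  then have "f \<in> slice_regular nonreal" "f \<in> L2_slice" by (auto simp: fock_full_def)
  then show "f \<in> fock_eigenspace 0"
    using slice_regular_nonreal_box[of f] by (simp add: fock_eigenspace_def)
qed

end
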